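(* Let $\theta_1$ and $\theta_2$ be $\mu$-preserving Borel actions of $\mathbb F_\infty$ on $X=\{0,1\}^{\mathbb N}$ which are measured orbit equivalent, i.e. for $\mu$-almost every $x\in X$ the orbits $\theta_1(\mathbb F_\infty,x)$ and $\theta_2(\mathbb F_\infty,x)$ coincide (so both actions generate the same measured equivalence relation). If $\theta_1$ is sofic, then $\theta_2$ is sofic. Consequently, soficity is a property of the measured equivalence relation rather than of the particular generating action.
   Context: Let $X=\{0,1\}^{\mathbb N}$ with $\mu$ the product of the uniform measures on $\{0,1\}$. Let $\mathbb F_\infty$ be the free group on generators $\gamma_1,\gamma_2,\dots$. For $r\ge 0$ let $W_r\subset\mathbb F_\infty$ be the set of reduced words of length at most $r$ in the letters $\gamma_1^{\pm1},\dots,\gamma_r^{\pm1}$. A labelled finite set is a finite set $Y$ together with a map assigning to each $y\in Y$ a label in $\{0,1\}^{\mathbb N}$; points of $X$ are labelled by themselves. For an action $\theta$ of $\mathbb F_\infty$ (on $X$ or on a labelled finite set) and a point $x$, the $r$-labelled $r$-neighbourhood $B^r_r(x)$ is the rooted directed multigraph with vertex set $\theta(W_r,x)$ and root $x$, having, for each vertex $y$, each $i\le r$ and each $\epsilon\in\{1,-1\}$ with $\theta(\gamma_i^{\epsilon},y)$ in the vertex set, a directed edge from $y$ to $\theta(\gamma_i^\epsilon,y)$ coloured $\gamma_i^\epsilon$ (loops and multiple edges allowed), and in which each vertex carries as label the first $r$ digits of its label. Let $U^{r,r}$ be the finite set of isomorphism classes of such objects (isomorphisms preserving root, colours and labels).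 For $\alpha\in U^{r,r}$ put $T(\theta,\alpha)=\{x: B^r_r(x)\cong\alpha\}$ and $p_\alpha(\theta)=\mu(T(\theta,\alpha))$ for a Borel action on $X$, resp. $p_\alpha(\theta)=|T(\theta,\alpha)|/|Y|$ for an action on a labelled finite set $Y$. A Borel action $\theta$ of $\mathbb F_\infty$ on $X$ is sofic if there exist actions $\theta_n$ of $\mathbb F_\infty$ on labelled finite sets $Y_n$ such that $\lim_{n\to\infty}p_\alpha(\theta_n)=p_\alpha(\theta)$ for every $r\ge1$ and every $\alpha\in U^{r,r}$. *)

theory Defs
  imports "HOL-Probability.Probability"
begin

text \<open>Letters of the free group on generators gamma_1, gamma_2, ...:
  the letter (i, True) stands for gamma_(i+1) and (i, False) for its inverse.
  Elements of F_infinity are reduced words in these letters.\<close>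
type_synonym letter = "nat \<times> bool"

definition reduced :: "letter list \<Rightarrow> bool" where
  "reduced w \<longleftrightarrow> (\<forall>k. Suc k < length w \<longrightarrow>
      \<not> (fst (w ! k) = fst (w ! Suc k) \<and> snd (w ! k) \<noteq> snd (w ! Suc k)))"

definition W :: "nat \<Rightarrow> letter list set" where
  "W r = {w. reduced w \<and> length w \<le> r \<and> (\<forall>l\<in>set w. fst l < r)}"

definition word_act :: "(letter \<Rightarrow> 'a \<Rightarrow> 'a) \<Rightarrow> letter list \<Rightarrow> 'a \<Rightarrow> 'a" where
  "word_act act w x = foldr act w x"

definition nbhd_verts :: "(letter \<Rightarrow> 'a \<Rightarrow> 'a) \<Rightarrow> nat \<Rightarrow> 'a \<Rightarrow> 'a set" where
  "nbhd_verts act r x = (\<lambda>w. word_act act w x) ` W r"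

text \<open>Concrete rooted, edge-coloured, vertex-labelled directed multigraphs on
  natural-number vertices; they represent the isomorphism classes alpha.
  edge v l = Some u means an edge from v to u coloured by the letter l.\<close>
record rgraph =
  verts :: "nat set"
  root :: nat
  edge :: "nat \<Rightarrow> letter \<Rightarrow> nat option"
  lbl :: "nat \<Rightarrow> bool list"

definition nbhd_iso :: "(letter \<Rightarrow> 'a \<Rightarrow> 'a) \<Rightarrow> ('a \<Rightarrow> nat \<Rightarrow> bool) \<Rightarrow> nat \<Rightarrow> 'a \<Rightarrow> rgraph \<Rightarrow> bool" where
  "nbhd_iso act lab r x \<alpha> \<longleftrightarrow>
     (\<exists>f. bij_betw f (nbhd_verts act r x) (verts \<alpha>) \<and> f x = root \<alpha> \<and>
       (\<forall>y\<in>nbhd_verts act r x.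
          (\<forall>l. edge \<alpha> (f y) l =
                 (if fst l < r \<and> act l y \<in> nbhd_verts act r x then Some (f (act l y)) else None)) \<and>
          lbl \<alpha> (f y) = map (lab y) [0..<r]))"

text \<open>Cantor space with the uniform product measure (its sigma algebra is the Borel one).\<close>
definition cantor :: "(nat \<Rightarrow> bool) measure" where
  "cantor = (\<Pi>\<^sub>M i\<in>(UNIV::nat set). measure_pmf (pmf_of_set (UNIV::bool set)))"

text \<open>An action of F_infinity on X given by the images gen i of the generators gamma_(i+1).\<close>
definition act_X :: "(nat \<Rightarrow> (nat \<Rightarrow> bool) \<Rightarrow> (nat \<Rightarrow> bool)) \<Rightarrow> letter \<Rightarrow> (nat \<Rightarrow> bool) \<Rightarrow> (nat \<Rightarrow> bool)" where
  "act_X gen l = (if snd l then gen (fst l) else inv (gen (fst l)))"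

definition borel_action :: "(nat \<Rightarrow> (nat \<Rightarrow> bool) \<Rightarrow> (nat \<Rightarrow> bool)) \<Rightarrow> bool" where
  "borel_action gen \<longleftrightarrow> (\<forall>i. bij (gen i) \<and> gen i \<in> cantor \<rightarrow>\<^sub>M cantor \<and> inv (gen i) \<in> cantor \<rightarrow>\<^sub>M cantor)"

definition mu_preserving :: "(nat \<Rightarrow> (nat \<Rightarrow> bool) \<Rightarrow> (nat \<Rightarrow> bool)) \<Rightarrow> bool" where
  "mu_preserving gen \<longleftrightarrow> (\<forall>i. distr cantor cantor (gen i) = cantor)"

definition orbit_X :: "(nat \<Rightarrow> (nat \<Rightarrow> bool) \<Rightarrow> (nat \<Rightarrow> bool)) \<Rightarrow> (nat \<Rightarrow> bool) \<Rightarrow> (nat \<Rightarrow> bool) set" where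
  "orbit_X gen x = {word_act (act_X gen) w x | w. reduced w}"

definition p_X :: "(nat \<Rightarrow> (nat \<Rightarrow> bool) \<Rightarrow> (nat \<Rightarrow> bool)) \<Rightarrow> nat \<Rightarrow> rgraph \<Rightarrow> real" where
  "p_X gen r \<alpha> = measure cantor {x. nbhd_iso (act_X gen) (\<lambda>x. x) r x \<alpha>}"

text \<open>Actions on labelled finite sets Y (w.l.o.g. Y a finite set of naturals).\<close>
definition fin_action :: "nat set \<Rightarrow> (nat \<Rightarrow> nat \<Rightarrow> nat) \<Rightarrow> bool" where
  "fin_action Y gen \<longleftrightarrow> finite Y \<and> (\<forall>i. bij_betw (gen i) Y Y)"

definition act_Y :: "nat set \<Rightarrow> (nat \<Rightarrow> nat \<Rightarrow> nat) \<Rightarrow> letter \<Rightarrow> nat \<Rightarrow> nat" where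
  "act_Y Y gen l = (if snd l then gen (fst l) else inv_into Y (gen (fst l)))"

definition p_Y :: "nat set \<Rightarrow> (nat \<Rightarrow> nat \<Rightarrow> nat) \<Rightarrow> (nat \<Rightarrow> nat \<Rightarrow> bool) \<Rightarrow> nat \<Rightarrow> rgraph \<Rightarrow> real" where
  "p_Y Y gen lab r \<alpha> = real (card {y\<in>Y. nbhd_iso (act_Y Y gen) lab r y \<alpha>}) / real (card Y)"

definition sofic :: "(nat \<Rightarrow> (nat \<Rightarrow> bool) \<Rightarrow> (nat \<Rightarrow> bool)) \<Rightarrow> bool" where
  "sofic gen \<longleftrightarrow>
     (\<exists>(Y :: nat \<Rightarrow> nat set) (g :: nat \<Rightarrow> nat \<Rightarrow> nat \<Rightarrow> nat) (lab :: nat \<Rightarrow> nat \<Rightarrow> nat \<Rightarrow> bool).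
        (\<forall>n. fin_action (Y n) (g n)) \<and>
        (\<forall>r\<ge>1. \<forall>\<alpha>. (\<lambda>n. p_Y (Y n) (g n) (lab n) r \<alpha>) \<longlonglongrightarrow> p_X gen r \<alpha>))"

end

theory Submission
  imports Defs
begin

text \<open>Almost everywhere, each letter \<open>l\<close> of the second action moves \<open>x\<close> by a word of the first
  action, and this word depends measurably on \<open>x\<close>. Up to a small error it is therefore a word
  \<open>c l x\<close> from a finite list determined by finitely many digits of \<open>x\<close>. The rule \<open>c\<close> makes sense on
  every labelled system, in particular on the finite models of the first action, and local
  statistics of the simulated maps are determined by local statistics of the first action.
  In the space the simulated maps of a generator and of its inverse nearly cancel, and this is
  a local event, so they nearly cancel in the models as well. The simulated generator is hence
  injective on almost all of a finite model and can be completed there to a permutation. As both the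
  second action and these permutations preserve the measure, replacing them by the simulated maps
  changes the statistics of balls of bounded radius by little.\<close>

section \<open>Patterns and isomorphism classes\<close>

text \<open>Unreduced words are used so that concatenating words and substituting words for letters
  stays inside such sets. Letters and length are bounded separately to keep track of these
  substitutions.\<close>

definition words :: "nat \<Rightarrow> nat \<Rightarrow> letter list set" where
  "words r n = {w. length w \<le> n \<and> (\<forall>l\<in>set w. fst l < r)}"

text \<open>The words of length \<open>r + 1\<close> are needed because an edge of the neighbourhood may leave the
  words of length \<open>r\<close> and still end in a vertex. With them, the pattern carries exactly the same
  information as the isomorphism class.\<close>

definition pattern :: "(letter \<Rightarrow> 'a \<Rightarrow> 'a) \<Rightarrow> ('a \<Rightarrow> nat \<Rightarrow> bool) \<Rightarrow> nat \<Rightarrow> 'a \<Rightarrow>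
    (letter list \<times> letter list) set \<times> (letter list \<times> nat) set" where
  "pattern act lab r x =
     ({(u, v). u \<in> words r (Suc r) \<and> v \<in> words r r \<and> word_act act u x = word_act act v x},
      {(w, k). w \<in> words r r \<and> k < r \<and> lab (word_act act w x) k})"

text \<open>The group law in the form of cancellation of a letter against its inverse. It is
  relative to \<open>Z\<close> because the inverse letters of a finite model, given by
  \<open>inv_into\<close>, are meaningful only on the model; Borel actions take
  \<open>UNIV\<close>.\<close>

definition inverse_act_on :: "'a set \<Rightarrow> (letter \<Rightarrow> 'a \<Rightarrow> 'a) \<Rightarrow> bool" where
  "inverse_act_on Z act \<longleftrightarrow>
     (\<forall>l. \<forall>x\<in>Z. act l x \<in> Z \<and> act (fst l, \<not> snd l) (act l x) = x)"

lemma word_act_Nil [simp]: "word_act act [] x = x"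
  by (simp add: word_act_def)

lemma word_act_Cons [simp]: "word_act act (l # w) x = act l (word_act act w x)"
  by (simp add: word_act_def)

lemma word_act_append: "word_act act (u @ v) x = word_act act u (word_act act v x)"
  by (simp add: word_act_def)

lemma Nil_in_words [simp]: "[] \<in> words r n"
  by (simp add: words_def)

lemma Cons_in_words_Suc [simp]: "l # w \<in> words r (Suc n) \<longleftrightarrow> fst l < r \<and> w \<in> words r n"
  by (auto simp: words_def)

lemma words_mono: "w \<in> words r n \<Longrightarrow> r \<le> r' \<Longrightarrow> n \<le> n' \<Longrightarrow> w \<in> words r' n'"
  by (force simp: words_def)

lemma finite_words: "finite (words r n)"
proof -
  have "words r n \<subseteq> {w. set w \<subseteq> {..<r} \<times> UNIV \<and> length w \<le> n}"
    by (auto simp: words_def mem_Times_iff)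
  then show ?thesis
    by (rule finite_subset) (rule finite_lists_length_le, simp)
qed

lemma pattern_in:
  "pattern act lab r x \<in> Pow (words r (Suc r) \<times> words r r) \<times> Pow (words r r \<times> {..<r})"
  by (auto simp: pattern_def)

lemma finite_pattern_range:
  "finite (Pow (words r (Suc r) \<times> words r r) \<times> Pow (words r r \<times> {..<r}))"
  by (simp add: finite_words)

lemma pattern_eq_act:
  assumes "pattern act lab r x = pattern act' lab' r x'" "u \<in> words r (Suc r)" "v \<in> words r r"
  shows "word_act act u x = word_act act v x \<longleftrightarrow> word_act act' u x' = word_act act' v x'"
proof -
  have "(u, v) \<in> fst (pattern act lab r x) \<longleftrightarrow> (u, v) \<in> fst (pattern act' lab' r x')"
    using assms(1) by simp
  then show ?thesis using assms(2,3) by (simp add: pattern_def)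
qed

lemma pattern_eq_lab:
  assumes "pattern act lab r x = pattern act' lab' r x'" "w \<in> words r r" "k < r"
  shows "lab (word_act act w x) k = lab' (word_act act' w x') k"
proof -
  have "(w, k) \<in> snd (pattern act lab r x) \<longleftrightarrow> (w, k) \<in> snd (pattern act' lab' r x')"
    using assms(1) by simp
  then show ?thesis using assms(2,3) by (simp add: pattern_def)
qed

lemma reduced_Cons:
  "reduced (l # l' # w) \<longleftrightarrow> \<not> (fst l = fst l' \<and> snd l \<noteq> snd l') \<and> reduced (l' # w)"
proof -
  have all_nat: "(\<forall>k. Q k) \<longleftrightarrow> Q 0 \<and> (\<forall>k. Q (Suc k))" for Q :: "nat \<Rightarrow> bool"
    by (metis not0_implies_Suc)
  show ?thesis
    unfolding reduced_def by (subst all_nat) simp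
qed

lemma reduced_Nil [simp]: "reduced []"
  and reduced_single [simp]: "reduced [l]"
  by (auto simp: reduced_def)

lemma reduced_tl: "reduced (l # w) \<Longrightarrow> reduced w"
  by (cases w) (auto simp: reduced_Cons)

lemma word_act_in:
  "inverse_act_on Z act \<Longrightarrow> x \<in> Z \<Longrightarrow> word_act act w x \<in> Z"
  by (induction w) (auto simp: inverse_act_on_def)

text \<open>A letter put in front of a reduced word either keeps it reduced or cancels against its
  first letter, and on \<open>Z\<close> cancelling does not change the endpoint.\<close>

lemma ex_reduced_word:
  assumes "inverse_act_on Z act" "x \<in> Z"
  shows "\<exists>w'. reduced w' \<and> length w' \<le> length w \<and> set w' \<subseteq> set w \<and>
           word_act act w' x = word_act act w x"
proof (induction w)
  case Nil
  show ?case by (intro exI[of _ "[]"]) simp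
next
  case (Cons l w)
  then obtain w' where w': "reduced w'" "length w' \<le> length w" "set w' \<subseteq> set w"
    "word_act act w' x = word_act act w x" by blast
  show ?case
  proof (cases "reduced (l # w')")
    case True
    then show ?thesis using w' by (intro exI[of _ "l # w'"]) auto
  next
    case False
    then obtain l' u where u: "w' = l' # u" "fst l = fst l'" "snd l \<noteq> snd l'"
      using w'(1) by (cases w') (auto simp: reduced_Cons)
    have "l = (fst l', \<not> snd l')" using u by (simp add: prod_eq_iff)
    moreover have "word_act act u x \<in> Z" using assms by (rule word_act_in)
    ultimately have "act l (act l' (word_act act u x)) = word_act act u x"
      using assms(1) unfolding inverse_act_on_def by metis
    then show ?thesis using w' u reduced_tl[of l' u]
      by (intro exI[of _ u]) (auto simp: w'(4)[symmetric])
  qed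
qed

text \<open>Free reduction neither lengthens a word nor introduces letters, so unreduced words reach
  no further vertices.\<close>

lemma nbhd_verts_eq:
  assumes "inverse_act_on Z act" "x \<in> Z"
  shows "nbhd_verts act r x = (\<lambda>w. word_act act w x) ` words r r"
proof
  show "nbhd_verts act r x \<subseteq> (\<lambda>w. word_act act w x) ` words r r"
    by (auto simp: nbhd_verts_def W_def words_def)
  show "(\<lambda>w. word_act act w x) ` words r r \<subseteq> nbhd_verts act r x"
  proof
    fix y assume "y \<in> (\<lambda>w. word_act act w x) ` words r r"
    then obtain w where w: "w \<in> words r r" "y = word_act act w x" by blast
    obtain w' where "reduced w'" "length w' \<le> length w" "set w' \<subseteq> set w"
      "word_act act w' x = word_act act w x"
      using ex_reduced_word[OF assms] by blast
    then show "y \<in> nbhd_verts act r x"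
      using w unfolding nbhd_verts_def W_def words_def by (intro image_eqI[of _ _ w']) auto
  qed
qed

text \<open>The graph counterpart of \<open>word_act\<close>: edges are followed from the root,
  rightmost letter first.\<close>

fun trace :: "rgraph \<Rightarrow> letter list \<Rightarrow> nat option" where
  "trace \<alpha> [] = Some (root \<alpha>)"
| "trace \<alpha> (l # w) = (case trace \<alpha> w of None \<Rightarrow> None | Some v \<Rightarrow> edge \<alpha> v l)"

definition graph_pattern :: "nat \<Rightarrow> rgraph \<Rightarrow>
    (letter list \<times> letter list) set \<times> (letter list \<times> nat) set" where
  "graph_pattern r \<alpha> =
     ({(u, v). u \<in> words r (Suc r) \<and> v \<in> words r r \<and> trace \<alpha> u = trace \<alpha> v},
      {(w, k). w \<in> words r r \<and> k < r \<and> lbl \<alpha> (the (trace \<alpha> w)) ! k})"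

text \<open>The isomorphism sends endpoints of words to traces, and its injectivity turns
  coincidences of endpoints into coincidences of traces. The right side mentions only \<alpha>, so
  points of different systems with this neighbourhood share one pattern.\<close>

lemma nbhd_iso_imp_pattern:
  assumes sys: "inverse_act_on Z act" "x \<in> Z" and iso: "nbhd_iso act lab r x \<alpha>"
  shows "pattern act lab r x = graph_pattern r \<alpha>"
proof -
  let ?N = "nbhd_verts act r x"
  obtain f where f: "bij_betw f ?N (verts \<alpha>)" "f x = root \<alpha>"
    and edge: "\<And>y l. y \<in> ?N \<Longrightarrow> edge \<alpha> (f y) l =
      (if fst l < r \<and> act l y \<in> ?N then Some (f (act l y)) else None)"
    and lbl: "\<And>y. y \<in> ?N \<Longrightarrow> lbl \<alpha> (f y) = map (lab y) [0..<r]"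
    using iso unfolding nbhd_iso_def by blast
  have inj: "inj_on f ?N" using f(1) by (rule bij_betw_imp_inj_on)
  have N: "word_act act w x \<in> ?N" if "w \<in> words r r" for w
    using that nbhd_verts_eq[OF sys, of r] by blast
  have tr: "trace \<alpha> w = Some (f (word_act act w x))" if "w \<in> words r r" for w
    using that
  proof (induction w)
    case Nil
    then show ?case by (simp add: f(2))
  next
    case (Cons l w)
    then have w: "w \<in> words r r" "fst l < r" by (auto simp: words_def)
    then show ?case using Cons edge[OF N[OF w(1)], of l] N[OF Cons.prems] by auto
  qed
  \<comment> \<open>The trace of \<open>v\<close> is always defined. If \<open>u\<close> has length
    \<open>r + 1\<close> and leaves the neighbourhood, its trace is \<open>None\<close>, so
    \<open>u\<close> and \<open>v\<close> differ on both sides.\<close>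
  have eq: "trace \<alpha> u = trace \<alpha> v \<longleftrightarrow> word_act act u x = word_act act v x"
    if u: "u \<in> words r (Suc r)" and v: "v \<in> words r r" for u v
  proof (cases u)
    case Nil
    then show ?thesis using tr[of "[]"] tr[OF v] N[OF v] N[of "[]"] inj
      by (auto simp: inj_on_eq_iff)
  next
    case (Cons l w)
    then have w: "w \<in> words r r" "fst l < r" using u by auto
    then show ?thesis
      using Cons tr[OF w(1)] tr[OF v] edge[OF N[OF w(1)], of l] N[OF v] inj
      by (auto simp: inj_on_eq_iff)
  qed
  have lab: "lbl \<alpha> (the (trace \<alpha> w)) ! k \<longleftrightarrow> lab (word_act act w x) k"
    if "w \<in> words r r" "k < r" for w k
    using that by (simp add: tr lbl N)
  show ?thesis
    unfolding pattern_def graph_pattern_def using eq lab by auto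
qed

text \<open>Sending the endpoint of a word at \<open>x'\<close> to the endpoint of the same word at
  \<open>x\<close> is well defined and injective, since both patterns record the same coincidences.
  Composing with the isomorphism at \<open>x\<close> gives the one at \<open>x'\<close>.\<close>

lemma nbhd_iso_transfer:
  assumes sys: "inverse_act_on Z act" "x \<in> Z" and sys': "inverse_act_on Z' act'" "x' \<in> Z'"
    and pat: "pattern act lab r x = pattern act' lab' r x'"
    and iso: "nbhd_iso act lab r x \<alpha>"
  shows "nbhd_iso act' lab' r x' \<alpha>"
proof -
  let ?N = "nbhd_verts act r x" and ?N' = "nbhd_verts act' r x'"
  let ?a = "\<lambda>w. word_act act w x" and ?a' = "\<lambda>w. word_act act' w x'"
  note N = nbhd_verts_eq[OF sys, of r] and N' = nbhd_verts_eq[OF sys', of r]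
  obtain f where f: "bij_betw f ?N (verts \<alpha>)" "f x = root \<alpha>"
    and edge: "\<And>y l. y \<in> ?N \<Longrightarrow> edge \<alpha> (f y) l =
      (if fst l < r \<and> act l y \<in> ?N then Some (f (act l y)) else None)"
    and lbl: "\<And>y. y \<in> ?N \<Longrightarrow> lbl \<alpha> (f y) = map (lab y) [0..<r]"
    using iso unfolding nbhd_iso_def by blast
  have eq: "?a u = ?a v \<longleftrightarrow> ?a' u = ?a' v" if "u \<in> words r (Suc r)" "v \<in> words r r" for u v
    using pattern_eq_act[OF pat that] .
  have S: "w \<in> words r (Suc r)" if "w \<in> words r r" for w
    using that by (rule words_mono) auto
  define h where "h y = ?a (SOME w. w \<in> words r r \<and> ?a' w = y)" for y
  have h: "h (?a' w) = ?a w" if w: "w \<in> words r r" for w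
  proof -
    let ?v = "SOME v. v \<in> words r r \<and> ?a' v = ?a' w"
    have "?v \<in> words r r \<and> ?a' ?v = ?a' w" by (rule someI[of _ w]) (simp add: w)
    then show ?thesis using eq[OF S[OF w], of ?v] by (simp add: h_def)
  qed
  have hN: "h ` ?N' = ?N" unfolding N N' using h by (force simp: image_iff)
  have "inj_on h ?N'" unfolding N' by (rule inj_onI) (use h eq S in auto)
  then have bij: "bij_betw (f \<circ> h) ?N' (verts \<alpha>)"
    using hN f(1) by (intro bij_betw_trans[of h _ ?N]) (auto simp: bij_betw_def)
  \<comment> \<open>The word \<open>l # w\<close> may have length \<open>r + 1\<close>. Its
    coincidences with words of length at most \<open>r\<close> decide whether the edge ends inside
    the neighbourhood, and where.\<close>
  have mem: "act l (?a w) \<in> ?N \<longleftrightarrow> act' l (?a' w) \<in> ?N'"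
    and step: "act' l (?a' w) \<in> ?N' \<Longrightarrow> h (act' l (?a' w)) = act l (?a w)"
    if "w \<in> words r r" "fst l < r" for w l
  proof -
    have lw: "l # w \<in> words r (Suc r)" using that by simp
    have e: "act l (?a w) = ?a v \<longleftrightarrow> act' l (?a' w) = ?a' v" if "v \<in> words r r" for v
      using eq[OF lw that] by simp
    show "act l (?a w) \<in> ?N \<longleftrightarrow> act' l (?a' w) \<in> ?N'"
      unfolding N N' using e by auto
    assume "act' l (?a' w) \<in> ?N'"
    then obtain v where v: "v \<in> words r r" "act' l (?a' w) = ?a' v" unfolding N' by auto
    then show "h (act' l (?a' w)) = act l (?a w)" using h[OF v(1)] e[OF v(1)] by simp
  qed
  show ?thesis unfolding nbhd_iso_def
  proof (intro exI[of _ "f \<circ> h"] conjI ballI allI)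
    show "bij_betw (f \<circ> h) ?N' (verts \<alpha>)" by (rule bij)
    show "(f \<circ> h) x' = root \<alpha>" using h[of "[]"] f(2) by simp
    fix y assume "y \<in> ?N'"
    then obtain w where w: "w \<in> words r r" "y = ?a' w" unfolding N' by auto
    have aw: "?a w \<in> ?N" using w(1) unfolding N by blast
    show "edge \<alpha> ((f \<circ> h) y) l =
        (if fst l < r \<and> act' l y \<in> ?N' then Some ((f \<circ> h) (act' l y)) else None)" for l
      using edge[OF aw, of l] mem[OF w(1), of l] step[OF w(1), of l] h[OF w(1)] w(2) by auto
    show "lbl \<alpha> ((f \<circ> h) y) = map (lab' y) [0..<r]"
      using lbl[OF aw] h[OF w(1)] w pattern_eq_lab[OF pat w(1)] by auto
  qed
qed

text \<open>A neighbourhood is finite, so its vertices can be numbered injectively and its structure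
  carried over to the numbers.\<close>

lemma ex_nbhd_iso: "\<exists>\<alpha>. nbhd_iso act lab r x \<alpha>"
proof -
  let ?N = "nbhd_verts act r x"
  have "W r \<subseteq> words r r" by (auto simp: W_def words_def)
  then have "finite ?N"
    unfolding nbhd_verts_def using finite_words finite_subset by blast
  then obtain f :: "'a \<Rightarrow> nat" where f: "inj_on f ?N"
    using finite_imp_inj_to_nat_seg by blast
  define g where "g = the_inv_into ?N f"
  have g: "g (f y) = y" if "y \<in> ?N" for y
    using the_inv_into_f_f[OF f that] by (simp add: g_def)
  show ?thesis unfolding nbhd_iso_def
    by (rule exI[of _ "\<lparr>verts = f ` ?N, root = f x,
        edge = (\<lambda>v l. if fst l < r \<and> act l (g v) \<in> ?N then Some (f (act l (g v))) else None),
        lbl = (\<lambda>v. map (lab (g v)) [0..<r])\<rparr>"], rule exI[of _ f])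
      (simp add: g inj_on_imp_bij_betw[OF f])
qed

section \<open>Cylinder approximation in Cantor space\<close>

lemma prob_space_cantor: "prob_space cantor"
  unfolding cantor_def by (intro prob_space_PiM prob_space_measure_pmf)

lemma space_cantor [simp]: "space cantor = UNIV"
  by (simp add: cantor_def space_PiM)

lemma measurable_coord [measurable]: "(\<lambda>x. x i) \<in> cantor \<rightarrow>\<^sub>M count_space UNIV"
proof -
  have "(\<lambda>x. x i) \<in> cantor \<rightarrow>\<^sub>M measure_pmf (pmf_of_set (UNIV :: bool set))"
    unfolding cantor_def by (rule measurable_component_singleton) simp
  then show ?thesis by (simp cong: measurable_cong_sets)
qed

text \<open>Equality of sequences is a countable conjunction of measurable conditions on
  digits.\<close>

lemma sets_cantor_eq:
  assumes [measurable]: "f \<in> cantor \<rightarrow>\<^sub>M cantor" "g \<in> cantor \<rightarrow>\<^sub>M cantor"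
  shows "{x. f x = g x} \<in> sets cantor"
proof -
  have [measurable]: "(\<lambda>x. f x i) \<in> cantor \<rightarrow>\<^sub>M count_space UNIV"
    "(\<lambda>x. g x i) \<in> cantor \<rightarrow>\<^sub>M count_space UNIV" for i
    using measurable_compose[OF assms(1) measurable_coord[of i]]
      measurable_compose[OF assms(2) measurable_coord[of i]] by simp_all
  have "{x. f x = g x} = {x \<in> space cantor. \<forall>i. f x i = g x i}"
    by (auto simp: fun_eq_iff)
  also have "\<dots> \<in> sets cantor" by measurable
  finally show ?thesis .
qed

text \<open>For predicates these are the finite unions of cylinders. For rules it is the property
  that allows evaluation from finitely many digits of a label.\<close>

definition prefix_determined :: "nat \<Rightarrow> ((nat \<Rightarrow> bool) \<Rightarrow> 'c) \<Rightarrow> bool" where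
  "prefix_determined k f \<longleftrightarrow> (\<forall>x y. (\<forall>i<k. x i = y i) \<longrightarrow> f x = f y)"

lemma prefix_determinedD:
  "prefix_determined k f \<Longrightarrow> (\<And>i. i < k \<Longrightarrow> x i = y i) \<Longrightarrow> f x = f y"
  by (auto simp: prefix_determined_def)

lemma prefix_determined_mono: "prefix_determined k f \<Longrightarrow> k \<le> k' \<Longrightarrow> prefix_determined k' f"
  by (auto simp: prefix_determined_def)

lemma prefix_determined_ex:
  assumes "\<And>i. i < n \<Longrightarrow> prefix_determined k (P i)"
  shows "prefix_determined k (\<lambda>x. \<exists>i<(n::nat). P i x)"
  unfolding prefix_determined_def
proof (intro allI impI)
  fix x y :: "nat \<Rightarrow> bool" assume "\<forall>i<k. x i = y i"
  then have "P i x = P i y" if "i < n" for i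
    using prefix_determinedD[OF assms[OF that], of x y] by simp
  then show "(\<exists>i<n. P i x) = (\<exists>i<n. P i y)" by blast
qed

lemma sets_prefix_determined:
  assumes "prefix_determined k P"
  shows "{x. P x} \<in> sets cantor"
proof -
  \<comment> \<open>The lists \<open>l\<close> run through the prefixes of length \<open>k\<close>.
    The value of \<open>nth l\<close> beyond position \<open>k\<close> is unspecified, but
    \<open>P\<close> does not look there.\<close>
  have "{x. P x} = (\<Union>l\<in>{l. length l = k \<and> P (nth l)}. {x \<in> space cantor. \<forall>i<k. x i = l ! i})"
    (is "_ = ?R")
  proof (intro set_eqI iffI)
    fix x assume "x \<in> {x. P x}"
    moreover have "P (nth (map x [0..<k])) = P x"
      by (rule prefix_determinedD[OF assms]) simp
    ultimately show "x \<in> ?R" by (intro UN_I[of "map x [0..<k]"]) auto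
  next
    fix x assume "x \<in> ?R"
    then obtain l where "P (nth l)" "\<forall>i<k. x i = l ! i" by auto
    then show "x \<in> {x. P x}" using prefix_determinedD[OF assms, of x "nth l"] by auto
  qed
  also have "\<dots> \<in> sets cantor"
  proof -
    have "{x \<in> space cantor. \<forall>i\<in>{..<k}. x i = l ! i} \<in> sets cantor" for l by measurable
    then have "{x \<in> space cantor. \<forall>i<k. x i = l ! i} \<in> sets cantor" for l
      by (simp add: Ball_def)
    then show ?thesis by (intro sets.countable_UN'') auto
  qed
  finally show ?thesis .
qed

lemma measurable_prefix_determined:
  assumes "prefix_determined k f"
  shows "f \<in> cantor \<rightarrow>\<^sub>M count_space UNIV"
proof (rule measurableI)
  fix A :: "'a set"
  have "prefix_determined k (\<lambda>x. f x \<in> A)"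
    using assms unfolding prefix_determined_def by metis
  from sets_prefix_determined[OF this]
  show "f -` A \<inter> space cantor \<in> sets cantor" by (simp add: vimage_def)
qed simp

text \<open>Continuity of the measure from below along the partial unions.\<close>

lemma finite_unions_approx:
  fixes A :: "nat \<Rightarrow> 'b set"
  assumes "finite_measure M" "range A \<subseteq> sets M" "e > 0"
  shows "\<exists>n. measure M ((\<Union>i. A i) - (\<Union>i<n. A i)) < e"
proof -
  interpret finite_measure M by fact
  have A: "A i \<in> sets M" for i using assms(2) by auto
  let ?B = "\<lambda>n. (\<Union>i<n. A i)"
  have "(\<lambda>n. measure M (?B n)) \<longlonglongrightarrow> measure M (\<Union>n. ?B n)"
    using A by (intro finite_Lim_measure_incseq) (auto simp: incseq_def, force)
  moreover have "(\<Union>n. ?B n) = (\<Union>i. A i)" by auto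
  ultimately have "eventually (\<lambda>n. measure M (?B n) > measure M (\<Union>i. A i) - e) sequentially"
    using assms(3) by (intro order_tendstoD(1)[of _ "measure M (\<Union>i. A i)"]) auto
  then obtain n where n: "measure M (?B n) > measure M (\<Union>i. A i) - e"
    by (auto simp: eventually_sequentially)
  have "measure M ((\<Union>i. A i) - ?B n) = measure M (\<Union>i. A i) - measure M (?B n)"
    using A by (intro finite_measure_Diff) auto
  then show ?thesis using n by (intro exI[of _ n]) simp
qed

text \<open>The sets approximable by cylinders include the coordinate generators and are closed
  under complements and countable unions, so induction over the generated sigma algebra reaches
  every Borel set.\<close>

lemma cylinder_approx:
  assumes "A \<in> sets cantor" "e > 0"
  shows "\<exists>k P. prefix_determined k P \<and> measure cantor {x. P x \<noteq> (x \<in> A)} < e"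
proof -
  interpret prob_space cantor by (rule prob_space_cantor)
  have sets_eq: "sets cantor = sigma_sets UNIV {{x. x i \<in> B} | i B. True}"
    unfolding cantor_def sets_PiM_single by (simp add: PiE_def)
  have "A \<in> sigma_sets UNIV {{x. x i \<in> B} | i B. True}"
    using assms(1) sets_eq by simp
  then show ?thesis using assms(2)
  proof (induction arbitrary: e)
    case (Basic A)
    then obtain i B where A: "A = {x. x i \<in> B}" by blast
    have "prefix_determined (Suc i) (\<lambda>x. x \<in> A)"
      by (auto simp: A prefix_determined_def)
    then show ?case using Basic by (intro exI[of _ "Suc i"] exI[of _ "\<lambda>x. x \<in> A"]) simp
  next
    case Empty
    then show ?case
      by (intro exI[of _ 0] exI[of _ "\<lambda>x. False"]) (simp add: prefix_determined_def)
  next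
    case (Compl A)
    then obtain k P where P: "prefix_determined k P" "measure cantor {x. P x \<noteq> (x \<in> A)} < e"
      by blast
    have "prefix_determined k (\<lambda>x. \<not> P x)"
      using P(1) unfolding prefix_determined_def by metis
    moreover have "{x. (\<not> P x) \<noteq> (x \<in> UNIV - A)} = {x. P x \<noteq> (x \<in> A)}" by auto
    ultimately show ?case using P(2) by (intro exI[of _ k] exI[of _ "\<lambda>x. \<not> P x"]) simp
  next
    case (Union A)
    have A [measurable]: "A i \<in> sets cantor" for i using Union.hyps sets_eq by simp
    have "\<exists>n. measure cantor ((\<Union>i. A i) - (\<Union>i<n. A i)) < e / 2"
      using A Union.prems by (intro finite_unions_approx finite_measure_axioms) auto
    then obtain n where n: "measure cantor ((\<Union>i. A i) - (\<Union>i<n. A i)) < e / 2" ..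
    \<comment> \<open>Half of \<open>e\<close> is spent on the tail of the union, the other half is
      shared among the first \<open>n\<close> sets; the \<open>+ 1\<close> covers
      \<open>n = 0\<close>.\<close>
    let ?e = "e / (2 * (real n + 1))"
    have "\<exists>k P. prefix_determined k P \<and> measure cantor {x. P x \<noteq> (x \<in> A i)} < ?e" for i
      using Union.prems by (intro Union.IH) simp
    then obtain k P where P: "\<And>i. prefix_determined (k i) (P i)"
      "\<And>i. measure cantor {x. P i x \<noteq> (x \<in> A i)} < ?e" by metis
    define Q where "Q x \<longleftrightarrow> (\<exists>i<n. P i x)" for x
    have "prefix_determined (\<Sum>i<n. k i) (P i)" if "i < n" for i
      using P(1) by (rule prefix_determined_mono) (use that in \<open>auto intro: member_le_sum\<close>)
    then have Q: "prefix_determined (\<Sum>i<n. k i) Q"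
      unfolding Q_def by (rule prefix_determined_ex)
    have [measurable]: "{x. P i x} \<in> sets cantor" for i
      using P(1) by (rule sets_prefix_determined)
    have D: "{x. P i x \<noteq> (x \<in> A i)} \<in> sets cantor" for i
    proof -
      have "{x. P i x \<noteq> (x \<in> A i)} = ({x. P i x} - A i) \<union> (A i - {x. P i x})" by auto
      then show ?thesis by simp
    qed
    let ?D = "\<Union>i<n. {x. P i x \<noteq> (x \<in> A i)}"
    have "measure cantor ?D \<le> (\<Sum>i<n. measure cantor {x. P i x \<noteq> (x \<in> A i)})"
      using D by (intro finite_measure_subadditive_finite) auto
    also have "\<dots> \<le> (\<Sum>i<n. ?e)" using P(2) by (intro sum_mono less_imp_le)
    also have "\<dots> \<le> e / 2" using Union.prems by (simp add: field_simps)
    finally have D_le: "measure cantor ?D \<le> e / 2" .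
    have "measure cantor {x. Q x \<noteq> (x \<in> (\<Union>i. A i))}
        \<le> measure cantor (((\<Union>i. A i) - (\<Union>i<n. A i)) \<union> ?D)"
      using A D by (intro finite_measure_mono) (auto simp: Q_def)
    also have "\<dots> \<le> measure cantor ((\<Union>i. A i) - (\<Union>i<n. A i)) + measure cantor ?D"
      using A D by (intro measure_Un_le) auto
    also have "\<dots> < e" using n D_le by simp
    finally show ?case using Q by blast
  qed
qed

lemma words_bound: "\<exists>k. w \<in> words k k"
proof -
  have "fst l < length w + (\<Sum>l\<leftarrow>w. Suc (fst l))" if "l \<in> set w" for l
    using member_le_sum_list[of "Suc (fst l)" "map (\<lambda>l. Suc (fst l)) w"] that by auto
  then show ?thesis
    by (intro exI[of _ "length w + (\<Sum>l\<leftarrow>w. Suc (fst l))"]) (auto simp: words_def)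
qed

lemma finite_words_bound:
  assumes "finite F"
  shows "\<exists>k. F \<subseteq> words k k"
  using assms
proof induction
  case (insert w F)
  then obtain k where k: "F \<subseteq> words k k" by blast
  obtain j where "w \<in> words j j" using words_bound by blast
  then show ?case using k
    by (intro exI[of _ "max j k"]) (auto intro: words_mono)
qed auto

lemma measurable_act_X:
  "borel_action gen \<Longrightarrow> act_X gen l \<in> cantor \<rightarrow>\<^sub>M cantor"
  by (auto simp: borel_action_def act_X_def)

lemma measurable_word_act:
  assumes "\<And>l. l \<in> set w \<Longrightarrow> s l \<in> cantor \<rightarrow>\<^sub>M cantor"
  shows "word_act s w \<in> cantor \<rightarrow>\<^sub>M cantor"
  using assms
proof (induction w)
  case Nil
  have "word_act s [] = (\<lambda>x. x)" by (simp add: fun_eq_iff)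
  then show ?case by simp
next
  case (Cons l w)
  have "(\<lambda>x. s l (word_act s w x)) \<in> cantor \<rightarrow>\<^sub>M cantor"
    by (rule measurable_compose[of "word_act s w" _ cantor]) (use Cons in auto)
  moreover have "word_act s (l # w) = (\<lambda>x. s l (word_act s w x))" by (simp add: fun_eq_iff)
  ultimately show ?case by simp
qed

text \<open>A pattern is settled by finitely many equalities of measurable maps and finitely many
  digits. These conditions do not see entries of \<open>c\<close> outside the possible range, so
  such \<open>c\<close>, whose fibre is empty, are split off first.\<close>

lemma sets_pattern:
  assumes "\<And>l. fst l < r \<Longrightarrow> s l \<in> cantor \<rightarrow>\<^sub>M cantor"
  shows "{x. pattern s (\<lambda>x. x) r x = c} \<in> sets cantor"
proof (cases "c \<in> Pow (words r (Suc r) \<times> words r r) \<times> Pow (words r r \<times> {..<r})")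
  case False
  then have "pattern s (\<lambda>x. x) r x \<noteq> c" for x
    using pattern_in[of s "\<lambda>x. x" r x] by metis
  then show ?thesis by simp
next
  case True
  have w [measurable]: "word_act s w \<in> cantor \<rightarrow>\<^sub>M cantor" if "w \<in> words r n" for w n
    using that assms by (intro measurable_word_act) (auto simp: words_def)
  let ?E = "words r (Suc r) \<times> words r r" and ?L = "words r r \<times> {..<r}"
  have E: "{x \<in> space cantor. (word_act s (fst p) x = word_act s (snd p) x) = (p \<in> fst c)}
      \<in> sets cantor" if "p \<in> ?E" for p
  proof -
    have "{x. word_act s (fst p) x = word_act s (snd p) x} \<in> sets cantor"
      using sets_cantor_eq[OF w w, of "fst p" "Suc r" "snd p" r] that by auto
    from this sets.compl_sets[OF this] show ?thesis
      by (cases "p \<in> fst c") (simp_all add: Collect_neg_eq Compl_eq_Diff_UNIV)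
  qed
  have L: "{x \<in> space cantor. word_act s (fst p) x (snd p) = (p \<in> snd c)} \<in> sets cantor"
    if "p \<in> ?L" for p
  proof -
    have [measurable]: "(\<lambda>x. word_act s (fst p) x (snd p)) \<in> cantor \<rightarrow>\<^sub>M count_space UNIV"
      using that measurable_compose[OF w measurable_coord] by (auto simp: mem_Times_iff)
    show ?thesis by measurable
  qed
  have "(\<forall>p\<in>?E. (word_act s (fst p) x = word_act s (snd p) x) = (p \<in> fst c)) \<longleftrightarrow>
      fst (pattern s (\<lambda>x. x) r x) = fst c" for x
    using True by (fastforce simp: pattern_def)
  moreover have "(\<forall>p\<in>?L. word_act s (fst p) x (snd p) = (p \<in> snd c)) \<longleftrightarrow>
      snd (pattern s (\<lambda>x. x) r x) = snd c" for x
    using True by (fastforce simp: pattern_def)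
  ultimately have "{x. pattern s (\<lambda>x. x) r x = c} =
      {x \<in> space cantor. \<forall>p\<in>?E. (word_act s (fst p) x = word_act s (snd p) x) = (p \<in> fst c)} \<inter>
      {x \<in> space cantor. \<forall>p\<in>?L. word_act s (fst p) x (snd p) = (p \<in> snd c)}"
    by (auto simp: prod_eq_iff)
  also have "\<dots> \<in> sets cantor"
    by (intro sets.Int sets.sets_Collect_finite_All E L) (simp_all add: finite_words)
  finally show ?thesis .
qed

text \<open>The sets where a given word describes \<open>f\<close> are countably many and cover
  almost every point. Finitely many of them suffice up to \<open>e / 2\<close>, and replacing these
  by cylinders costs the other half.\<close>

lemma cylinder_cocycle_approx:
  assumes gen: "borel_action gen" and f: "f \<in> cantor \<rightarrow>\<^sub>M cantor"
    and orb: "AE x in cantor. \<exists>w. f x = word_act (act_X gen) w x" and "e > 0"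
  shows "\<exists>c k. prefix_determined k c \<and> (\<forall>x. c x \<in> words k k) \<and>
     measure cantor {x. f x \<noteq> word_act (act_X gen) (c x) x} < e"
proof -
  interpret prob_space cantor by (rule prob_space_cantor)
  let ?w = "\<lambda>n x. word_act (act_X gen) (from_nat n) x"
  define A where "A n = {x. f x = ?w n x}" for n
  have A [measurable]: "A n \<in> sets cantor" for n
    unfolding A_def using gen by (intro sets_cantor_eq f measurable_word_act measurable_act_X)
  have "AE x in cantor. x \<in> (\<Union>n. A n)"
    using orb
  proof eventually_elim
    case (elim x)
    then obtain w where "f x = word_act (act_X gen) w x" ..
    then have "x \<in> A (to_nat w)" by (simp add: A_def)
    then show ?case by blast
  qed
  then have full: "measure cantor (UNIV - (\<Union>n. A n)) = 0"
    using prob_eq_1[of "\<Union>n. A n"] prob_compl[of "\<Union>n. A n"] by simp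
  obtain N where N: "measure cantor ((\<Union>i. A i) - (\<Union>i<N. A i)) < e / 2"
    using finite_unions_approx[OF finite_measure_axioms, of A "e / 2"] A half_gt_zero[OF \<open>e > 0\<close>]
    by blast
  let ?e = "e / (2 * (real N + 1))"
  have "\<exists>k P. prefix_determined k P \<and> measure cantor {x. P x \<noteq> (x \<in> A i)} < ?e" for i
    using \<open>e > 0\<close> by (intro cylinder_approx A) simp
  then obtain k P where P: "\<And>i. prefix_determined (k i) (P i)"
    "\<And>i. measure cantor {x. P i x \<noteq> (x \<in> A i)} < ?e" by metis
  \<comment> \<open>The cylinders may overlap; taking the least index resolves this by a rule that
    sees only the digits read by the \<open>P i\<close>. The default \<open>[]\<close> applies where
    no \<open>P i\<close> holds.\<close>
  define c :: "(nat \<Rightarrow> bool) \<Rightarrow> letter list" where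
    "c x = (if \<exists>i<N. P i x then from_nat (LEAST i. i < N \<and> P i x) else [])" for x
  let ?F = "insert [] (from_nat ` {..<N}) :: letter list set"
  obtain j where j: "?F \<subseteq> words j j" using finite_words_bound[of ?F] by auto
  define K where "K = (\<Sum>i<N. k i) + j"
  have least: "(LEAST i. i < N \<and> P i x) < N \<and> P (LEAST i. i < N \<and> P i x) x"
    if "\<exists>i<N. P i x" for x
    using that LeastI_ex[of "\<lambda>i. i < N \<and> P i x"] by blast
  have c_words: "c x \<in> words K K" for x
  proof -
    have "c x \<in> ?F" using least[of x] by (auto simp: c_def)
    then have "c x \<in> words j j" using j by blast
    then show ?thesis by (rule words_mono) (simp_all add: K_def)
  qed
  have "k i \<le> K" if "i < N" for i
  proof -
    have "k i \<le> (\<Sum>i<N. k i)" using that by (intro member_le_sum) auto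
    then show ?thesis by (simp add: K_def)
  qed
  then have PK: "prefix_determined K (P i)" if "i < N" for i
    using prefix_determined_mono[OF P(1)] that by blast
  have c: "prefix_determined K c" unfolding prefix_determined_def
  proof (intro allI impI)
    fix x y :: "nat \<Rightarrow> bool" assume "\<forall>i<K. x i = y i"
    then have P_eq: "(i < N \<and> P i x) = (i < N \<and> P i y)" for i
      using PK[of i] by (auto simp: prefix_determined_def)
    then have "(\<exists>i<N. P i x) = (\<exists>i<N. P i y)" by blast
    then show "c x = c y" unfolding c_def P_eq by simp
  qed
  have [measurable]: "{x. P i x} \<in> sets cantor" for i
    using P(1) by (rule sets_prefix_determined)
  have D: "{x. P i x \<noteq> (x \<in> A i)} \<in> sets cantor" for i
  proof -
    have "{x. P i x \<noteq> (x \<in> A i)} = ({x. P i x} - A i) \<union> (A i - {x. P i x})" by auto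
    then show ?thesis by simp
  qed
  let ?D = "\<Union>i<N. {x. P i x \<noteq> (x \<in> A i)}"
  have "measure cantor ?D \<le> (\<Sum>i<N. measure cantor {x. P i x \<noteq> (x \<in> A i)})"
    using D by (intro finite_measure_subadditive_finite) auto
  also have "\<dots> \<le> (\<Sum>i<N. ?e)" using P(2) by (intro sum_mono less_imp_le)
  also have "\<dots> \<le> e / 2" using \<open>e > 0\<close> by (simp add: field_simps)
  finally have D_le: "measure cantor ?D \<le> e / 2" .
  let ?R = "((\<Union>i. A i) - (\<Union>i<N. A i))"
  have Z_sets: "UNIV - (\<Union>n. A n) \<in> sets cantor"
    using sets.compl_sets[of "\<Union>n. A n" cantor] A by simp
  have RD_sets: "?R \<union> ?D \<in> sets cantor" using A D by (intro sets.Un sets.Diff) auto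
  \<comment> \<open>An error has one of three causes: no word works, only words of index at least
    \<open>N\<close> work, or some \<open>P i\<close> misjudges its set. Otherwise the least index
    names a set that really contains \<open>x\<close>.\<close>
  have "{x. f x \<noteq> word_act (act_X gen) (c x) x} \<subseteq> (UNIV - (\<Union>n. A n)) \<union> (?R \<union> ?D)"
  proof
    fix x assume x: "x \<in> {x. f x \<noteq> word_act (act_X gen) (c x) x}"
    show "x \<in> (UNIV - (\<Union>n. A n)) \<union> (?R \<union> ?D)"
    proof (rule ccontr)
      assume "\<not> ?thesis"
      then obtain i where "i < N" "x \<in> A i" and PA: "\<And>i. i < N \<Longrightarrow> P i x = (x \<in> A i)" by blast
      then have ex: "\<exists>i<N. P i x" by blast
      then have "x \<in> A (LEAST i. i < N \<and> P i x)" using least[OF ex] PA by blast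
      then show False using x ex by (simp add: c_def A_def)
    qed
  qed
  then have "measure cantor {x. f x \<noteq> word_act (act_X gen) (c x) x}
      \<le> measure cantor ((UNIV - (\<Union>n. A n)) \<union> (?R \<union> ?D))"
    by (rule finite_measure_mono) (intro sets.Un Z_sets RD_sets)
  also have "\<dots> \<le> measure cantor (UNIV - (\<Union>n. A n)) + measure cantor (?R \<union> ?D)"
    by (intro measure_Un_le Z_sets RD_sets)
  also have "measure cantor (?R \<union> ?D) \<le> measure cantor ?R + measure cantor ?D"
    using A D by (intro measure_Un_le) auto
  finally have "measure cantor {x. f x \<noteq> word_act (act_X gen) (c x) x} < e"
    using full N D_le by simp
  then show ?thesis using c c_words by blast
qed

section \<open>Finite models and convergence of determined events\<close>

lemma inverse_act_on_X: "borel_action gen \<Longrightarrow> inverse_act_on UNIV (act_X gen)"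
  by (auto simp: inverse_act_on_def act_X_def borel_action_def bij_is_inj bij_is_surj surj_f_inv_f)

lemma bij_betw_act_Y:
  "fin_action Y gen \<Longrightarrow> bij_betw (act_Y Y gen l) Y Y"
  by (auto simp: fin_action_def act_Y_def bij_betw_inv_into)

lemma inverse_act_on_Y:
  assumes "fin_action Y gen"
  shows "inverse_act_on Y (act_Y Y gen)"
proof -
  have b: "bij_betw (gen i) Y Y" for i using assms by (simp add: fin_action_def)
  have "act_Y Y gen l x \<in> Y" if "x \<in> Y" for l x
    using bij_betwE[OF bij_betw_act_Y[OF assms]] that by blast
  moreover have "act_Y Y gen (fst l, \<not> snd l) (act_Y Y gen l x) = x" if "x \<in> Y" for l x
    using that b[of "fst l"]
    by (simp add: act_Y_def bij_betw_inv_into_left bij_betw_inv_into_right)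
  ultimately show ?thesis by (simp add: inverse_act_on_def)
qed

text \<open>Finite measure rather than probability, because the carrier of a finite action may be
  empty.\<close>

lemma finite_measure_uniform_count_measure:
  assumes "finite Y"
  shows "finite_measure (uniform_count_measure Y)"
  by (rule finite_measureI)
    (use assms in \<open>simp add: emeasure_uniform_count_measure space_uniform_count_measure\<close>)

lemma measure_uniform_Collect:
  "finite Y \<Longrightarrow> measure (uniform_count_measure Y) {y\<in>Y. P y} = real (card {y\<in>Y. P y}) / real (card Y)"
  by (rule measure_uniform_count_measure) auto

text \<open>An event determined by a pattern from a finite range is a finite disjoint union of
  pattern fibres, whose measures converge one by one. The hypotheses on \<open>P\<close> and
  \<open>Q\<close> let one set of patterns describe the event in all systems.\<close>

lemma tendsto_measure_determined_event:
  assumes M: "finite_measure M" and N: "\<And>n. finite_measure (N n)" and F: "finite F"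
    and pF: "\<And>x. x \<in> space M \<Longrightarrow> p x \<in> F" and qF: "\<And>n y. y \<in> space (N n) \<Longrightarrow> q n y \<in> F"
    and p_sets: "\<And>c. {x \<in> space M. p x = c} \<in> sets M"
    and q_sets: "\<And>n c. {y \<in> space (N n). q n y = c} \<in> sets (N n)"
    and conv: "\<And>c. (\<lambda>n. measure (N n) {y \<in> space (N n). q n y = c})
      \<longlonglongrightarrow> measure M {x \<in> space M. p x = c}"
    and P: "\<And>x x'. x \<in> space M \<Longrightarrow> x' \<in> space M \<Longrightarrow> p x = p x' \<Longrightarrow> P x = P x'"
    and Q: "\<And>n n' y y'. y \<in> space (N n) \<Longrightarrow> y' \<in> space (N n') \<Longrightarrow> q n y = q n' y' \<Longrightarrow> Q n y = Q n' y'"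
    and PQ: "\<And>n x y. x \<in> space M \<Longrightarrow> y \<in> space (N n) \<Longrightarrow> p x = q n y \<Longrightarrow> P x = Q n y"
  shows "(\<lambda>n. measure (N n) {y \<in> space (N n). Q n y}) \<longlonglongrightarrow> measure M {x \<in> space M. P x}"
proof -
  \<comment> \<open>Patterns are collected over all systems at once, so that \<open>S\<close> does
    not depend on \<open>n\<close> and the sums below have a fixed index set.\<close>
  define S where "S = p ` {x \<in> space M. P x} \<union> (\<Union>n. q n ` {y \<in> space (N n). Q n y})"
  have S: "finite S"
    by (rule finite_subset[OF _ F]) (use pF qF in \<open>auto simp: S_def\<close>)
  have PS: "P x \<longleftrightarrow> p x \<in> S" if "x \<in> space M" for x
  proof
    assume "p x \<in> S"
    then consider x' where "x' \<in> space M" "P x'" "p x = p x'"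
      | n y where "y \<in> space (N n)" "Q n y" "p x = q n y" by (auto simp: S_def)
    then show "P x" by cases (use P[OF that] PQ[OF that] in \<open>blast+\<close>)
  qed (use that in \<open>auto simp: S_def\<close>)
  have QS: "Q n y \<longleftrightarrow> q n y \<in> S" if "y \<in> space (N n)" for n y
  proof
    assume "q n y \<in> S"
    then consider x' where "x' \<in> space M" "P x'" "q n y = p x'"
      | n' y' where "y' \<in> space (N n')" "Q n' y'" "q n y = q n' y'" by (auto simp: S_def)
    then show "Q n y"
    proof cases
      case 1
      then show ?thesis using PQ[OF 1(1) that] by simp
    next
      case 2
      then show ?thesis using Q[OF that 2(1)] by simp
    qed
  qed (use that in \<open>auto simp: S_def\<close>)
  have "measure M {x \<in> space M. P x} = measure M (\<Union>c\<in>S. {x \<in> space M. p x = c})"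
    by (rule arg_cong[where f = "measure M"]) (auto simp: PS)
  also have "\<dots> = (\<Sum>c\<in>S. measure M {x \<in> space M. p x = c})"
    using M S p_sets by (intro finite_measure.finite_measure_finite_Union)
      (auto simp: disjoint_family_on_def)
  finally have 1: "measure M {x \<in> space M. P x} = (\<Sum>c\<in>S. measure M {x \<in> space M. p x = c})" .
  have 2: "measure (N n) {y \<in> space (N n). Q n y}
      = (\<Sum>c\<in>S. measure (N n) {y \<in> space (N n). q n y = c})" for n
  proof -
    have "measure (N n) {y \<in> space (N n). Q n y}
        = measure (N n) (\<Union>c\<in>S. {y \<in> space (N n). q n y = c})"
      by (rule arg_cong[where f = "measure (N n)"]) (auto simp: QS)
    also have "\<dots> = (\<Sum>c\<in>S. measure (N n) {y \<in> space (N n). q n y = c})"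
      using N S q_sets by (intro finite_measure.finite_measure_finite_Union)
        (auto simp: disjoint_family_on_def)
    finally show ?thesis .
  qed
  show ?thesis unfolding 1 2 by (intro tendsto_sum conv)
qed

section \<open>Soficity in terms of pattern frequencies\<close>

definition pattern_freq_X :: "(nat \<Rightarrow> (nat \<Rightarrow> bool) \<Rightarrow> (nat \<Rightarrow> bool)) \<Rightarrow> nat \<Rightarrow>
    (letter list \<times> letter list) set \<times> (letter list \<times> nat) set \<Rightarrow> real" where
  "pattern_freq_X gen r c = measure cantor {x. pattern (act_X gen) (\<lambda>x. x) r x = c}"

text \<open>Written with a measure instead of a quotient of cardinalities, so that the same
  measure-theoretic lemmas serve the models and the space.\<close>

definition pattern_freq_Y :: "nat set \<Rightarrow> (nat \<Rightarrow> nat \<Rightarrow> nat) \<Rightarrow> (nat \<Rightarrow> nat \<Rightarrow> bool) \<Rightarrow> nat \<Rightarrow>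
    (letter list \<times> letter list) set \<times> (letter list \<times> nat) set \<Rightarrow> real" where
  "pattern_freq_Y Y gen lab r c =
     measure (uniform_count_measure Y) {y\<in>Y. pattern (act_Y Y gen) lab r y = c}"

text \<open>Either some point has a neighbourhood isomorphic to the graph, and then all points with
  that neighbourhood share one pattern, or the frequency is zero in all systems.\<close>

lemma sofic_iff_pattern:
  assumes gen: "borel_action gen"
  shows "sofic gen \<longleftrightarrow>
     (\<exists>Y g lab. (\<forall>n. fin_action (Y n) (g n)) \<and>
        (\<forall>r\<ge>1. \<forall>c. (\<lambda>n. pattern_freq_Y (Y n) (g n) (lab n) r c) \<longlonglongrightarrow> pattern_freq_X gen r c))"
proof -
  note X = inverse_act_on_X[OF gen]
  have "(\<forall>\<alpha>. (\<lambda>n. p_Y (Y n) (g n) (lab n) r \<alpha>) \<longlonglongrightarrow> p_X gen r \<alpha>) \<longleftrightarrow>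
      (\<forall>c. (\<lambda>n. pattern_freq_Y (Y n) (g n) (lab n) r c) \<longlonglongrightarrow> pattern_freq_X gen r c)"
    if fin: "\<forall>n. fin_action (Y n) (g n)" for Y g lab r
  proof -
    note YY = inverse_act_on_Y[OF fin[rule_format]]
    have finY: "finite (Y n)" for n using fin by (auto simp: fin_action_def)
    let ?isoX = "\<lambda>x. nbhd_iso (act_X gen) (\<lambda>x. x) r x"
    let ?isoY = "\<lambda>n. nbhd_iso (act_Y (Y n) (g n)) (lab n) r"
    let ?patX = "pattern (act_X gen) (\<lambda>x. x) r"
    let ?patY = "\<lambda>n. pattern (act_Y (Y n) (g n)) (lab n) r"
    \<comment> \<open>A joint witness in a single system already identifies the class of \<alpha>
      with the pattern \<open>c\<close> in every system.\<close>
    have eq: "p_X gen r \<alpha> = pattern_freq_X gen r c \<and>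
        (\<forall>n. p_Y (Y n) (g n) (lab n) r \<alpha> = pattern_freq_Y (Y n) (g n) (lab n) r c)"
      if *: "(\<exists>x. ?isoX x \<alpha> \<and> ?patX x = c) \<or> (\<exists>n. \<exists>y\<in>Y n. ?isoY n y \<alpha> \<and> ?patY n y = c)" for \<alpha> c
    proof -
      have c: "c = graph_pattern r \<alpha>"
        using * nbhd_iso_imp_pattern[OF X UNIV_I] nbhd_iso_imp_pattern[OF YY] by blast
      have "?isoX x \<alpha> \<longleftrightarrow> ?patX x = c" for x
      proof
        assume x: "?patX x = c"
        show "?isoX x \<alpha>" using *
        proof (elim disjE exE bexE conjE)
          fix x' assume "?isoX x' \<alpha>" "?patX x' = c"
          then show ?thesis using nbhd_iso_transfer[OF X UNIV_I X UNIV_I] x by metis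
        next
          fix n y assume "y \<in> Y n" "?isoY n y \<alpha>" "?patY n y = c"
          then show ?thesis using nbhd_iso_transfer[OF YY _ X UNIV_I] x by metis
        qed
      qed (simp add: c nbhd_iso_imp_pattern[OF X UNIV_I])
      moreover have "?isoY n y \<alpha> \<longleftrightarrow> ?patY n y = c" if "y \<in> Y n" for n y
      proof
        assume y: "?patY n y = c"
        show "?isoY n y \<alpha>" using *
        proof (elim disjE exE bexE conjE)
          fix x' assume "?isoX x' \<alpha>" "?patX x' = c"
          then show ?thesis using nbhd_iso_transfer[OF X UNIV_I YY that] y by metis
        next
          fix n' y' assume "y' \<in> Y n'" "?isoY n' y' \<alpha>" "?patY n' y' = c"
          then show ?thesis using nbhd_iso_transfer[OF YY _ YY that] y by metis
        qed
      qed (simp add: c nbhd_iso_imp_pattern[OF YY that])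
      ultimately show ?thesis
        by (auto simp: p_X_def p_Y_def pattern_freq_X_def pattern_freq_Y_def
            measure_uniform_Collect[OF finY] cong: conj_cong)
    qed
    show ?thesis
    proof (intro iffI allI)
      fix c assume conv: "\<forall>\<alpha>. (\<lambda>n. p_Y (Y n) (g n) (lab n) r \<alpha>) \<longlonglongrightarrow> p_X gen r \<alpha>"
      show "(\<lambda>n. pattern_freq_Y (Y n) (g n) (lab n) r c) \<longlonglongrightarrow> pattern_freq_X gen r c"
      proof (cases "(\<exists>x. ?patX x = c) \<or> (\<exists>n. \<exists>y\<in>Y n. ?patY n y = c)")
        case True
        then obtain \<alpha> where
          "(\<exists>x. ?isoX x \<alpha> \<and> ?patX x = c) \<or> (\<exists>n. \<exists>y\<in>Y n. ?isoY n y \<alpha> \<and> ?patY n y = c)"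
          using ex_nbhd_iso[of "act_X gen" "\<lambda>x. x" r]
            ex_nbhd_iso[of "act_Y (Y n) (g n)" "lab n" r for n] by blast
        from eq[OF this] conv[rule_format, of \<alpha>] show ?thesis by simp
      next
        case False
        then have empty: "{x. ?patX x = c} = {}" "\<And>n. {y \<in> Y n. ?patY n y = c} = {}" by auto
        then show ?thesis unfolding pattern_freq_X_def pattern_freq_Y_def empty by simp
      qed
    next
      fix \<alpha>
      assume conv: "\<forall>c. (\<lambda>n. pattern_freq_Y (Y n) (g n) (lab n) r c) \<longlonglongrightarrow> pattern_freq_X gen r c"
      show "(\<lambda>n. p_Y (Y n) (g n) (lab n) r \<alpha>) \<longlonglongrightarrow> p_X gen r \<alpha>"
      proof (cases "(\<exists>x. ?isoX x \<alpha>) \<or> (\<exists>n. \<exists>y\<in>Y n. ?isoY n y \<alpha>)")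
        case True
        then obtain c where
          "(\<exists>x. ?isoX x \<alpha> \<and> ?patX x = c) \<or> (\<exists>n. \<exists>y\<in>Y n. ?isoY n y \<alpha> \<and> ?patY n y = c)"
          by blast
        from eq[OF this] conv[rule_format, of c] show ?thesis by simp
      next
        case False
        then have empty: "{x. ?isoX x \<alpha>} = {}" "\<And>n. {y \<in> Y n. ?isoY n y \<alpha>} = {}" by auto
        then show ?thesis unfolding p_X_def p_Y_def empty by simp
      qed
    qed
  qed
  then show ?thesis unfolding sofic_def by blast
qed

section \<open>Simulating one action inside another\<close>

text \<open>The rule \<open>c\<close> reads the label of the current point and picks the word to
  follow. A generator and its inverse are simulated independently, so these maps need not be
  bijective or inverse to each other.\<close>

definition simulated :: "(letter \<Rightarrow> 'a \<Rightarrow> 'a) \<Rightarrow> ('a \<Rightarrow> nat \<Rightarrow> bool) \<Rightarrow>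
    (letter \<Rightarrow> (nat \<Rightarrow> bool) \<Rightarrow> letter list) \<Rightarrow> letter \<Rightarrow> 'a \<Rightarrow> 'a" where
  "simulated act lab c l x = word_act act (c l (lab x)) x"

text \<open>Each letter contributes at most \<open>K\<close> letters, chosen from \<open>K\<close>
  digits at the point reached so far. Equal patterns show equal digits there, so one word
  \<open>u\<close> serves both systems.\<close>

lemma simulated_word:
  assumes pat: "pattern act lab R x = pattern act' lab' R x'"
    and c: "\<And>l. fst l < m \<Longrightarrow> prefix_determined K (c l)"
    and c_words: "\<And>l z. fst l < m \<Longrightarrow> c l z \<in> words K K"
    and w: "w \<in> words m n" and R: "n * K + K \<le> R"
  shows "\<exists>u\<in>words K (n * K). word_act (simulated act lab c) w x = word_act act u x \<and>
    word_act (simulated act' lab' c) w x' = word_act act' u x'"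
  using w R
proof (induction w arbitrary: n)
  case Nil
  then show ?case by (intro bexI[of _ "[]"]) auto
next
  case (Cons l w)
  then obtain n' where n: "n = Suc n'" by (cases n) (auto simp: words_def)
  then have l: "fst l < m" and "w \<in> words m n'" using Cons.prems by auto
  then obtain u where u: "u \<in> words K (n' * K)"
    "word_act (simulated act lab c) w x = word_act act u x"
    "word_act (simulated act' lab' c) w x' = word_act act' u x'"
    using Cons.IH[of n'] Cons.prems n by auto
  have "u \<in> words R R"
    using u(1) by (rule words_mono) (use Cons.prems(2) n in auto)
  then have "c l (lab (word_act act u x)) = c l (lab' (word_act act' u x'))"
    using Cons.prems(2) by (intro prefix_determinedD[OF c[OF l]] pattern_eq_lab[OF pat]) auto
  moreover define v where "v = c l (lab (word_act act u x))"
  ultimately have "word_act (simulated act lab c) (l # w) x = word_act act (v @ u) x"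
    "word_act (simulated act' lab' c) (l # w) x' = word_act act' (v @ u) x'"
    by (simp_all add: u simulated_def word_act_append)
  moreover have "v @ u \<in> words K (n * K)"
    using u(1) c_words[OF l, of "lab (word_act act u x)"] by (auto simp: v_def n words_def)
  ultimately show ?case by blast
qed

text \<open>Simulated words unfold to common words of the underlying actions. In the bound,
  \<open>Suc m * K + K\<close> accounts for unfolding words of length \<open>m + 1\<close> together
  with the digits read by the rule, and \<open>m\<close> for the labels.\<close>

lemma pattern_simulated:
  assumes pat: "pattern act lab R x = pattern act' lab' R x'"
    and c: "\<And>l. fst l < m \<Longrightarrow> prefix_determined K (c l)"
    and c_words: "\<And>l z. fst l < m \<Longrightarrow> c l z \<in> words K K"
    and R: "Suc m * K + K + m \<le> R"
  shows "pattern (simulated act lab c) lab m x = pattern (simulated act' lab' c) lab' m x'"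
proof -
  let ?s = "simulated act lab c" and ?s' = "simulated act' lab' c"
  have ex: "\<exists>u. u \<in> words R R \<and> word_act ?s w x = word_act act u x \<and>
      word_act ?s' w x' = word_act act' u x'" if "w \<in> words m (Suc m)" for w
  proof -
    have "Suc m * K + K \<le> R" using R by simp
    from simulated_word[where m = m and c = c, OF pat c c_words that this]
    obtain u where u: "u \<in> words K (Suc m * K)" "word_act ?s w x = word_act act u x"
      "word_act ?s' w x' = word_act act' u x'" by blast
    from u(1) have "u \<in> words R R" by (rule words_mono) (use R in auto)
    then show ?thesis using u by blast
  qed
  have S: "w \<in> words m (Suc m)" if "w \<in> words m m" for w
    using that by (rule words_mono) auto
  have E: "word_act ?s u x = word_act ?s v x \<longleftrightarrow> word_act ?s' u x' = word_act ?s' v x'"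
    if u: "u \<in> words m (Suc m)" and v: "v \<in> words m m" for u v
  proof -
    obtain u' where u': "u' \<in> words R R" "word_act ?s u x = word_act act u' x"
      "word_act ?s' u x' = word_act act' u' x'" using ex[OF u] by blast
    obtain v' where v': "v' \<in> words R R" "word_act ?s v x = word_act act v' x"
      "word_act ?s' v x' = word_act act' v' x'" using ex[OF S[OF v]] by blast
    have "u' \<in> words R (Suc R)" using u'(1) by (rule words_mono) auto
    from pattern_eq_act[OF pat this v'(1)] show ?thesis using u' v' by simp
  qed
  have L: "lab (word_act ?s w x) k = lab' (word_act ?s' w x') k"
    if w: "w \<in> words m m" and k: "k < m" for w k
  proof -
    obtain u where u: "u \<in> words R R" "word_act ?s w x = word_act act u x"
      "word_act ?s' w x' = word_act act' u x'" using ex[OF S[OF w]] by blast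
    then show ?thesis using pattern_eq_lab[OF pat u(1), of k] k R by simp
  qed
  show ?thesis using E L by (auto simp: pattern_def)
qed

text \<open>The measure-preserving system is applied along the word and the approximating maps are
  compared with it one letter at a time, so each of the finitely many comparisons costs at most
  one error term.\<close>

lemma pattern_perturbation:
  assumes M: "finite_measure M"
    and a: "\<And>l x. fst l < m \<Longrightarrow> x \<in> space M \<Longrightarrow> a l x \<in> space M"
    and a_sets: "\<And>l B. fst l < m \<Longrightarrow> B \<in> sets M \<Longrightarrow> {x \<in> space M. a l x \<in> B} \<in> sets M"
    and a_meas: "\<And>l B. fst l < m \<Longrightarrow> B \<in> sets M \<Longrightarrow>
      measure M {x \<in> space M. a l x \<in> B} \<le> measure M B"
    and bad_sets: "\<And>l. fst l < m \<Longrightarrow> {x \<in> space M. a l x \<noteq> s l x} \<in> sets M"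
    and bad: "\<And>l. fst l < m \<Longrightarrow> measure M {x \<in> space M. a l x \<noteq> s l x} \<le> d"
    and d: "0 \<le> d"
  shows "\<exists>U\<in>sets M. measure M U \<le> real (card (words m (Suc m))) * d \<and>
    (\<forall>x\<in>space M - U. \<forall>r\<le>m. pattern a lab r x = pattern s lab r x)"
proof -
  interpret finite_measure M by fact
  \<comment> \<open>In \<open>B u\<close> the two maps disagree at the head letter of
    \<open>u\<close>, after the tail \<open>w\<close> has been followed with \<open>a\<close>. It is
    a preimage under \<open>word_act a w\<close>, hence no larger than the bad set of that
    letter.\<close>
  define B where "B u = (case u of [] \<Rightarrow> {} | l # w \<Rightarrow>
    {x \<in> space M. a l (word_act a w x) \<noteq> s l (word_act a w x)})" for u
  have sp: "word_act a w x \<in> space M" if "w \<in> words m n" "x \<in> space M" for w n x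
    using that by (induction w) (auto simp: words_def a)
  have pull: "{x \<in> space M. word_act a w x \<in> C} \<in> sets M \<and>
      measure M {x \<in> space M. word_act a w x \<in> C} \<le> measure M C"
    if "C \<in> sets M" "w \<in> words m n" for w C n
    using that
  proof (induction w arbitrary: C)
    case Nil
    then have "{x \<in> space M. x \<in> C} = C" using sets.sets_into_space by blast
    then show ?case using Nil by simp
  next
    case (Cons l w)
    then have w: "w \<in> words m n" and l: "fst l < m" by (auto simp: words_def)
    have "{x \<in> space M. word_act a (l # w) x \<in> C} =
        {x \<in> space M. word_act a w x \<in> {x \<in> space M. a l x \<in> C}}"
      using sp[OF w] by auto
    then show ?case
      using Cons.IH[OF a_sets[OF l Cons.prems(1)] w] a_meas[OF l Cons.prems(1)] by simp
  qed
  have B: "B u \<in> sets M \<and> measure M (B u) \<le> d" if "u \<in> words m (Suc m)" for u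
  proof (cases u)
    case Nil
    then show ?thesis using d by (simp add: B_def)
  next
    case (Cons l w)
    then have w: "w \<in> words m m" and l: "fst l < m" using that by auto
    have "B u = {x \<in> space M. word_act a w x \<in> {x \<in> space M. a l x \<noteq> s l x}}"
      using sp[OF w] by (auto simp: B_def Cons)
    then show ?thesis using pull[OF bad_sets[OF l] w] bad[OF l] by simp
  qed
  let ?U = "\<Union>u\<in>words m (Suc m). B u"
  have agree: "word_act a w x = word_act s w x"
    if "x \<in> space M - ?U" "w \<in> words m (Suc m)" for x w
    using that(2)
  proof (induction w)
    case (Cons l w)
    then have "x \<notin> B (l # w)" using that(1) by blast
    moreover have "w \<in> words m (Suc m)" using Cons.prems by (auto simp: words_def)
    ultimately show ?case using Cons.IH that(1) by (auto simp: B_def)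
  qed simp
  show ?thesis
  proof (intro bexI[of _ ?U] conjI ballI allI impI)
    show "?U \<in> sets M" using B by (intro sets.finite_UN finite_words) auto
    have "measure M ?U \<le> (\<Sum>u\<in>words m (Suc m). measure M (B u))"
      using B by (intro finite_measure_subadditive_finite finite_words) auto
    also have "\<dots> \<le> (\<Sum>u\<in>words m (Suc m). d)" using B by (intro sum_mono) auto
    finally show "measure M ?U \<le> real (card (words m (Suc m))) * d" by simp
    fix x r assume x: "x \<in> space M - ?U" and "r \<le> m"
    then have "words r (Suc r) \<subseteq> words m (Suc m)" "words r r \<subseteq> words m (Suc m)"
      by (auto intro: words_mono)
    then have "word_act a w x = word_act s w x" if "w \<in> words r (Suc r) \<or> w \<in> words r r" for w
      using agree[OF x] that by blast
    then show "pattern a lab r x = pattern s lab r x"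
      unfolding pattern_def by (intro arg_cong2[where f = Pair] Collect_cong) auto
  qed
qed

lemma (in finite_measure) abs_measure_diff_le:
  assumes "A \<in> sets M" "B \<in> sets M" "U \<in> sets M"
    and "\<And>x. x \<in> space M - U \<Longrightarrow> x \<in> A \<longleftrightarrow> x \<in> B"
  shows "\<bar>measure M A - measure M B\<bar> \<le> measure M U"
proof -
  have sub: "A \<subseteq> B \<union> U" "B \<subseteq> A \<union> U"
    using assms sets.sets_into_space by blast+
  have "measure M A \<le> measure M (B \<union> U)" "measure M B \<le> measure M (A \<union> U)"
    using sub assms by (auto intro!: finite_measure_mono)
  moreover have "measure M (B \<union> U) \<le> measure M B + measure M U"
    "measure M (A \<union> U) \<le> measure M A + measure M U"
    using assms by (auto intro!: measure_Un_le)
  ultimately show ?thesis by linarith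
qed

lemma inj_on_extends_to_bij:
  assumes "finite Y" "G \<subseteq> Y" "inj_on f G" "f ` G \<subseteq> Y"
  shows "\<exists>h. bij_betw h Y Y \<and> (\<forall>y\<in>G. h y = f y)"
proof -
  have "card (Y - G) = card (Y - f ` G)"
    using assms by (simp add: card_Diff_subset finite_subset card_image)
  then obtain k where k: "bij_betw k (Y - G) (Y - f ` G)"
    using assms(1) finite_same_card_bij[of "Y - G" "Y - f ` G"] by auto
  let ?h = "\<lambda>y. if y \<in> G then f y else k y"
  have "bij_betw ?h G (f ` G)"
    using assms(3) by (auto simp: bij_betw_def inj_on_def)
  moreover have "bij_betw ?h (Y - G) (Y - f ` G)"
    using k by (subst bij_betw_cong[of _ _ k]) auto
  ultimately have "bij_betw ?h (G \<union> (Y - G)) (f ` G \<union> (Y - f ` G))"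
    by (rule bij_betw_combine) auto
  then have "bij_betw ?h Y Y" using assms by (simp add: Un_absorb1)
  then show ?thesis by (intro exI[of _ ?h]) simp
qed

section \<open>Transfer of finite models\<close>

text \<open>\<open>mu_preserving\<close> speaks of generators only. For an inverse letter it is
  applied to the preimage of \<open>B\<close> under the inverse, which the generator pulls back to
  \<open>B\<close>.\<close>

lemma measure_act_X_vimage:
  assumes "borel_action gen" "mu_preserving gen" "B \<in> sets cantor"
  shows "measure cantor {x. act_X gen l x \<in> B} = measure cantor B"
proof -
  define f where "f = gen (fst l)"
  have f: "bij f" "f \<in> cantor \<rightarrow>\<^sub>M cantor" "inv f \<in> cantor \<rightarrow>\<^sub>M cantor" "distr cantor cantor f = cantor"
    using assms by (auto simp: borel_action_def mu_preserving_def f_def)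
  have pres: "measure cantor {x. f x \<in> C} = measure cantor C" if "C \<in> sets cantor" for C
    using measure_distr[OF f(2) that] f(4) by (simp add: vimage_def)
  show ?thesis
  proof (cases "snd l")
    case True
    then show ?thesis using pres[OF assms(3)] by (simp add: act_X_def f_def)
  next
    case False
    have "{x. inv f x \<in> B} \<in> sets cantor"
      using measurable_sets[OF f(3) assms(3)] by (simp add: vimage_def)
    from pres[OF this] have "measure cantor {x. inv f x \<in> B} = measure cantor B"
      using f(1) by (simp add: bij_is_inj inv_f_f)
    then show ?thesis using False by (simp add: act_X_def f_def)
  qed
qed

text \<open>A return is a coincidence of a two-letter word with the empty word. As
  \<open>i < m\<close>, two letters do not exceed \<open>m + 1\<close>, so the simulated pattern
  records it.\<close>

lemma simulated_return:
  assumes pat: "pattern act lab R x = pattern act' lab' R x'"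
    and c: "\<And>l. fst l < m \<Longrightarrow> prefix_determined K (c l)"
    and c_words: "\<And>l z. fst l < m \<Longrightarrow> c l z \<in> words K K"
    and R: "Suc m * K + K + m \<le> R" and i: "i < m"
  shows "simulated act lab c (i, False) (simulated act lab c (i, True) x) = x \<longleftrightarrow>
    simulated act' lab' c (i, False) (simulated act' lab' c (i, True) x') = x'"
proof -
  have "[(i, False), (i, True)] \<in> words m (Suc m)" using i by (auto simp: words_def)
  from pattern_eq_act[OF pattern_simulated[where m = m and c = c, OF pat c c_words R] this Nil_in_words]
  show ?thesis by simp
qed

text \<open>A single model for a fixed bound on the radius and a fixed error; a diagonal choice over
  \<open>m\<close> then yields soficity.\<close>

lemma sofic_model_approx:
  fixes \<theta>1 \<theta>2 :: "nat \<Rightarrow> (nat \<Rightarrow> bool) \<Rightarrow> (nat \<Rightarrow> bool)"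
  assumes gen1: "borel_action \<theta>1" and gen2: "borel_action \<theta>2" and mu2: "mu_preserving \<theta>2"
    and orb: "AE x in cantor. orbit_X \<theta>1 x = orbit_X \<theta>2 x"
    and fin: "\<And>n. fin_action (Y n) (g n)"
    and conv: "\<And>r c. 1 \<le> r \<Longrightarrow>
      (\<lambda>n. pattern_freq_Y (Y n) (g n) (lab n) r c) \<longlonglongrightarrow> pattern_freq_X \<theta>1 r c"
    and e: "0 < e"
  shows "\<exists>Y g lab. fin_action Y g \<and>
    (\<forall>r\<le>m. \<forall>c. \<bar>pattern_freq_Y Y g lab r c - pattern_freq_X \<theta>2 r c\<bar> < e)"
proof -
  interpret X: prob_space cantor by (rule prob_space_cantor)
  have finY: "finite (Y n)" for n using fin by (auto simp: fin_action_def)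
  note fmY = finite_measure_uniform_count_measure[OF finY]
  let ?a1 = "act_X \<theta>1" and ?a2 = "act_X \<theta>2"
  define N where "N = real (card (words m (Suc m)))"
  \<comment> \<open>Passing between the actions and their simulations will cost
    \<open>N * (3 * d)\<close> in the model and \<open>N * d\<close> in the space, together at most
    \<open>e / 2\<close>. Convergence of the simulated frequencies costs a further
    \<open>e / 4\<close>.\<close>
  define d where "d = e / (8 * (N + 1))"
  have N: "0 \<le> N" by (simp add: N_def)
  have d: "0 < d" using e N by (simp add: d_def)
  have Nd: "N * d \<le> e / 8" using e N by (simp add: d_def field_simps)
  have m2 [measurable]: "?a2 l \<in> cantor \<rightarrow>\<^sub>M cantor" for l using gen2 by (rule measurable_act_X)

  \<comment> \<open>A finitary rule for the second action\<close>
  have "AE x in cantor. \<exists>w. ?a2 l x = word_act ?a1 w x" for l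
    using orb
  proof eventually_elim
    case (elim x)
    have "word_act ?a2 [l] x \<in> orbit_X \<theta>2 x" unfolding orbit_X_def using reduced_single by blast
    then show ?case using elim by (auto simp: orbit_X_def)
  qed
  then have ex: "\<forall>l. \<exists>c k. prefix_determined k c \<and> (\<forall>x. c x \<in> words k k) \<and>
      measure cantor {x. ?a2 l x \<noteq> word_act ?a1 (c x) x} < d"
    by (intro allI cylinder_cocycle_approx[OF gen1 m2 _ d])
  obtain c where c_ex: "\<forall>l. \<exists>k. prefix_determined k (c l) \<and> (\<forall>x. c l x \<in> words k k) \<and>
      measure cantor {x. ?a2 l x \<noteq> word_act ?a1 (c l x) x} < d"
    by (rule exE[OF choice[OF ex]])
  obtain k where k: "\<forall>l. prefix_determined (k l) (c l) \<and> (\<forall>x. c l x \<in> words (k l) (k l)) \<and>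
      measure cantor {x. ?a2 l x \<noteq> word_act ?a1 (c l x) x} < d"
    by (rule exE[OF choice[OF c_ex]])
  then have ck: "\<And>l. prefix_determined (k l) (c l)" "\<And>l x. c l x \<in> words (k l) (k l)"
    "\<And>l. measure cantor {x. ?a2 l x \<noteq> word_act ?a1 (c l x) x} < d"
    by blast+
  \<comment> \<open>A common bound for the finitely many letters of index below \<open>m\<close>,
    both signs included.\<close>
  define K where "K = (\<Sum>l\<in>{..<m} \<times> UNIV. k l)"
  have kK: "k l \<le> K" if "fst l < m" for l
    unfolding K_def using that by (intro member_le_sum) (auto simp: mem_Times_iff)
  have c: "prefix_determined K (c l)" if "fst l < m" for l
    using ck(1) kK[OF that] by (rule prefix_determined_mono)
  have c_words: "c l x \<in> words K K" if "fst l < m" for l x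
    by (rule words_mono[OF ck(2) kK[OF that] kK[OF that]])
  \<comment> \<open>The last summand is \<open>Suc m\<close> so that \<open>1 \<le> R\<close> holds
    even for \<open>m = 0\<close>, as \<open>conv\<close> demands.\<close>
  define R where "R = Suc m * K + K + Suc m"
  define s where "s = simulated ?a1 (\<lambda>x. x) c"
  define t where "t n = simulated (act_Y (Y n) (g n)) (lab n) c" for n
  have ms [measurable]: "s l \<in> cantor \<rightarrow>\<^sub>M cantor" for l
  proof -
    have "(\<lambda>x. word_act ?a1 (c l x) x) \<in> cantor \<rightarrow>\<^sub>M cantor"
      by (rule measurable_compose_countable[where f = "\<lambda>w. word_act ?a1 w" and g = "c l"])
        (intro measurable_word_act measurable_act_X gen1 measurable_prefix_determined[OF ck(1)])+
    then show ?thesis by (simp add: s_def simulated_def[abs_def])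
  qed

  \<comment> \<open>Errors of the simulation in Cantor space\<close>
  have badX_sets: "{x. ?a2 l x \<noteq> s l x} \<in> sets cantor" for l
  proof -
    have "UNIV - {x. ?a2 l x = s l x} \<in> sets cantor"
      using sets.compl_sets[OF sets_cantor_eq[OF m2 ms]] by simp
    then show ?thesis by (simp add: Collect_neg_eq Compl_eq_Diff_UNIV)
  qed
  have badX: "measure cantor {x. ?a2 l x \<noteq> s l x} \<le> d" for l
    using ck(3)[of l] by (simp add: s_def simulated_def)
  have a2_sets: "{x. ?a2 l x \<in> B} \<in> sets cantor" if "B \<in> sets cantor" for l B
    using measurable_sets[OF m2 that] by (simp add: vimage_def)
  \<comment> \<open>A failed return needs an error at the first letter or, pulled back by the
    preserving action, at the second: at most \<open>2 * d\<close>. The slack makes the bound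
    strict, so that it passes to all late models.\<close>
  have returnX: "measure cantor {x. s (i, False) (s (i, True) x) \<noteq> x} < 3 * d" for i
  proof -
    let ?B = "{x. ?a2 (i, False) x \<noteq> s (i, False) x}"
    let ?C = "{x. ?a2 (i, True) x \<noteq> s (i, True) x}" and ?D = "{x. ?a2 (i, True) x \<in> ?B}"
    have C: "?C \<in> sets cantor" by (rule badX_sets)
    have D: "?D \<in> sets cantor" by (rule a2_sets[OF badX_sets])
    have ret: "?a2 (i, False) (?a2 (i, True) x) = x" for x
      using inverse_act_on_X[OF gen2, unfolded inverse_act_on_def, rule_format, of x "(i, True)"]
      by simp
    have "{x. s (i, False) (s (i, True) x) \<noteq> x} \<subseteq> ?C \<union> ?D"
    proof (rule subsetI, rule ccontr)
      fix x assume "x \<in> {x. s (i, False) (s (i, True) x) \<noteq> x}" "x \<notin> ?C \<union> ?D"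
      then show False using ret[of x] by simp
    qed
    then have 1: "measure cantor {x. s (i, False) (s (i, True) x) \<noteq> x} \<le> measure cantor (?C \<union> ?D)"
      by (rule X.finite_measure_mono[OF _ sets.Un[OF C D]])
    have 2: "measure cantor (?C \<union> ?D) \<le> measure cantor ?C + measure cantor ?D"
      by (rule measure_Un_le[OF C D])
    have 3: "measure cantor ?D = measure cantor ?B"
      by (rule measure_act_X_vimage[OF gen2 mu2 badX_sets])
    show ?thesis using 1 2 3 badX[of "(i, True)"] badX[of "(i, False)"] d by linarith
  qed

  \<comment> \<open>Convergence of events determined by patterns\<close>
  have lim: "(\<lambda>n. measure (uniform_count_measure (Y n)) {y\<in>Y n. Q n y})
      \<longlonglongrightarrow> measure cantor {x. P x}"
    if P: "\<And>x x'. pattern ?a1 (\<lambda>x. x) R x = pattern ?a1 (\<lambda>x. x) R x' \<Longrightarrow> P x = P x'"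
      and Q: "\<And>n n' y y'. pattern (act_Y (Y n) (g n)) (lab n) R y
          = pattern (act_Y (Y n') (g n')) (lab n') R y' \<Longrightarrow> Q n y = Q n' y'"
      and PQ: "\<And>n x y. pattern ?a1 (\<lambda>x. x) R x = pattern (act_Y (Y n) (g n)) (lab n) R y
          \<Longrightarrow> P x = Q n y" for P Q
  proof -
    have "(\<lambda>n. measure (uniform_count_measure (Y n))
          {y\<in>space (uniform_count_measure (Y n)). Q n y})
        \<longlonglongrightarrow> measure cantor {x\<in>space cantor. P x}"
    proof (rule tendsto_measure_determined_event[where p = "pattern ?a1 (\<lambda>x. x) R"
          and q = "\<lambda>n. pattern (act_Y (Y n) (g n)) (lab n) R",
          OF X.finite_measure_axioms fmY finite_pattern_range pattern_in pattern_in])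
      show "{x \<in> space cantor. pattern ?a1 (\<lambda>x. x) R x = b} \<in> sets cantor" for b
        using sets_pattern[OF measurable_act_X[OF gen1]] by simp
      show "{y \<in> space (uniform_count_measure (Y n)). pattern (act_Y (Y n) (g n)) (lab n) R y = b}
          \<in> sets (uniform_count_measure (Y n))" for n b
        by (auto simp: space_uniform_count_measure sets_uniform_count_measure)
      have "1 \<le> R" by (simp add: R_def)
      from conv[OF this, of b for b]
      show "(\<lambda>n. measure (uniform_count_measure (Y n)) {y \<in> space (uniform_count_measure (Y n)).
            pattern (act_Y (Y n) (g n)) (lab n) R y = b})
          \<longlonglongrightarrow> measure cantor {x \<in> space cantor. pattern ?a1 (\<lambda>x. x) R x = b}" for b
        by (simp add: space_uniform_count_measure pattern_freq_X_def pattern_freq_Y_def)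
    qed (erule P Q PQ)+
    then show ?thesis by (simp add: space_uniform_count_measure)
  qed

  \<comment> \<open>Near-cancellation in the models\<close>
  have "\<forall>\<^sub>F n in sequentially. measure (uniform_count_measure (Y n))
      {y\<in>Y n. t n (i, False) (t n (i, True) y) \<noteq> y} < 3 * d" if i: "i < m" for i
  proof (rule order_tendstoD(2)[OF _ returnX[of i]], rule lim)
    have R: "Suc m * K + K + m \<le> R" by (simp add: R_def)
    note return = simulated_return[where m = m and c = c and K = K, OF _ c c_words R i]
    show "(s (i, False) (s (i, True) x) \<noteq> x) = (s (i, False) (s (i, True) x') \<noteq> x')"
      if "pattern ?a1 (\<lambda>x. x) R x = pattern ?a1 (\<lambda>x. x) R x'" for x x'
      using return[OF that] by (simp add: s_def)
    show "(t n (i, False) (t n (i, True) y) \<noteq> y) = (t n' (i, False) (t n' (i, True) y') \<noteq> y')"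
      if "pattern (act_Y (Y n) (g n)) (lab n) R y = pattern (act_Y (Y n') (g n')) (lab n') R y'"
      for n n' y y'
      using return[OF that] by (simp add: t_def)
    show "(s (i, False) (s (i, True) x) \<noteq> x) = (t n (i, False) (t n (i, True) y) \<noteq> y)"
      if "pattern ?a1 (\<lambda>x. x) R x = pattern (act_Y (Y n) (g n)) (lab n) R y" for n x y
      using return[OF that] by (simp add: s_def t_def)
  qed
  then have ev_return: "\<forall>\<^sub>F n in sequentially. \<forall>i\<in>{..<m}. measure (uniform_count_measure (Y n))
      {y\<in>Y n. t n (i, False) (t n (i, True) y) \<noteq> y} < 3 * d"
    by (intro eventually_ball_finite) auto

  \<comment> \<open>Simulated pattern frequencies and choice of a model\<close>
  let ?F = "\<lambda>r. Pow (words r (Suc r) \<times> words r r) \<times> Pow (words r r \<times> {..<r})"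
  let ?fY = "\<lambda>n r b. measure (uniform_count_measure (Y n)) {y\<in>Y n. pattern (t n) (lab n) r y = b}"
  let ?fX = "\<lambda>r b. measure cantor {x. pattern s (\<lambda>x. x) r x = b}"
  have "\<forall>\<^sub>F n in sequentially. \<bar>?fY n r b - ?fX r b\<bar> < e / 4" if r: "r \<le> m" for r b
  proof -
    have cr: "\<And>l. fst l < r \<Longrightarrow> prefix_determined K (c l)"
      "\<And>l z. fst l < r \<Longrightarrow> c l z \<in> words K K" using c c_words r by auto
    have "Suc r * K \<le> Suc m * K" using r by (intro mult_le_mono1) simp
    then have R: "Suc r * K + K + r \<le> R" using r unfolding R_def by linarith
    have "(\<lambda>n. ?fY n r b) \<longlonglongrightarrow> ?fX r b"
    proof (rule lim)
      note sim = pattern_simulated[where m = r and c = c and K = K, OF _ cr R]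
      show "(pattern s (\<lambda>x. x) r x = b) = (pattern s (\<lambda>x. x) r x' = b)"
        if "pattern ?a1 (\<lambda>x. x) R x = pattern ?a1 (\<lambda>x. x) R x'" for x x'
        using sim[OF that] by (simp add: s_def)
      show "(pattern (t n) (lab n) r y = b) = (pattern (t n') (lab n') r y' = b)"
        if "pattern (act_Y (Y n) (g n)) (lab n) R y = pattern (act_Y (Y n') (g n')) (lab n') R y'"
        for n n' y y'
        using sim[OF that] by (simp add: t_def)
      show "(pattern s (\<lambda>x. x) r x = b) = (pattern (t n) (lab n) r y = b)"
        if "pattern ?a1 (\<lambda>x. x) R x = pattern (act_Y (Y n) (g n)) (lab n) R y" for n x y
        using sim[OF that] by (simp add: s_def t_def)
    qed
    then have "\<forall>\<^sub>F n in sequentially. dist (?fY n r b) (?fX r b) < e / 4"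
      using e by (intro tendstoD) auto
    then show ?thesis by (simp add: dist_real_def)
  qed
  then have ev_pat: "\<forall>\<^sub>F n in sequentially. \<forall>r\<in>{..m}. \<forall>b\<in>?F r. \<bar>?fY n r b - ?fX r b\<bar> < e / 4"
    by (intro eventually_ball_finite ballI finite_pattern_range) auto
  from eventually_happens'[OF sequentially_bot eventually_conj[OF ev_return ev_pat]]
  obtain n where n: "\<forall>i\<in>{..<m}. measure (uniform_count_measure (Y n))
        {y\<in>Y n. t n (i, False) (t n (i, True) y) \<noteq> y} < 3 * d"
    "\<forall>r\<in>{..m}. \<forall>b\<in>?F r. \<bar>?fY n r b - ?fX r b\<bar> < e / 4"
    by (elim exE conjE)

  \<comment> \<open>Completion of the simulated generators to permutations\<close>
  let ?Y = "Y n" and ?t = "t n"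
  let ?M = "uniform_count_measure ?Y"
  interpret MY: finite_measure ?M by (rule fmY)
  have tY: "?t l y \<in> ?Y" if "y \<in> ?Y" for l y
    unfolding t_def simulated_def using word_act_in[OF inverse_act_on_Y[OF fin] that] .
  txt \<open>Having \<open>?t (i, False)\<close> as a left inverse makes \<open>?t (i, True)\<close> injective on \<open>G i\<close>. Being a
    return is a local event, so \<open>G i\<close> is almost all of \<open>?Y\<close>, and any bijective extension will do.\<close>
  define G where "G i = {y\<in>?Y. ?t (i, False) (?t (i, True) y) = y}" for i
  have "\<exists>h. bij_betw h ?Y ?Y \<and> (\<forall>y\<in>G i. h y = ?t (i, True) y)" for i
  proof (rule inj_on_extends_to_bij[OF finY])
    show "inj_on (?t (i, True)) (G i)"
      by (rule inj_on_inverseI[of _ "?t (i, False)"]) (simp add: G_def)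
  qed (auto simp: G_def tY)
  then obtain h where h: "\<And>i. bij_betw (h i) ?Y ?Y" "\<And>i y. y \<in> G i \<Longrightarrow> h i y = ?t (i, True) y"
    by metis
  let ?ah = "act_Y ?Y h"
  have fin_h: "fin_action ?Y h" using finY h(1) by (simp add: fin_action_def)
  note bij_ah = bij_betw_act_Y[OF fin_h]
  have card_bad: "card {y\<in>?Y. ?ah l y \<noteq> ?t l y} \<le> card (?Y - G (fst l))" for l
  proof (cases "snd l")
    case True
    then have "l = (fst l, True)" by (simp add: prod_eq_iff)
    then have "{y\<in>?Y. ?ah l y \<noteq> ?t l y} \<subseteq> ?Y - G (fst l)"
      using h(2)[of _ "fst l"] True by (auto simp: act_Y_def)
    then show ?thesis using finY by (intro card_mono) auto
  next
    case False
    then have l: "l = (fst l, False)" by (simp add: prod_eq_iff)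
    \<comment> \<open>If the preimage \<open>z\<close> of \<open>y\<close> under
      \<open>h (fst l)\<close> lies in \<open>G (fst l)\<close>, then \<open>?t l\<close> takes
      \<open>y\<close> back to \<open>z\<close>, as the inverse of \<open>h (fst l)\<close> does.
      Mismatches at inverse letters therefore come from points outside
      \<open>G (fst l)\<close>.\<close>
    have "{y\<in>?Y. ?ah l y \<noteq> ?t l y} \<subseteq> h (fst l) ` (?Y - G (fst l))"
    proof
      fix y assume y: "y \<in> {y\<in>?Y. ?ah l y \<noteq> ?t l y}"
      define z where "z = inv_into ?Y (h (fst l)) y"
      have z: "z \<in> ?Y" "h (fst l) z = y"
        using y h(1)[of "fst l"] bij_betwE[OF bij_betw_inv_into[OF h(1)[of "fst l"]]]
        by (auto simp: z_def bij_betw_inv_into_right)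
      have "z \<notin> G (fst l)"
      proof
        assume G: "z \<in> G (fst l)"
        then have "?t l y = z" using h(2)[OF G] z(2) l by (auto simp: G_def)
        then show False using y False by (simp add: act_Y_def z_def)
      qed
      then show "y \<in> h (fst l) ` (?Y - G (fst l))" using z by blast
    qed
    then have "card {y\<in>?Y. ?ah l y \<noteq> ?t l y} \<le> card (h (fst l) ` (?Y - G (fst l)))"
      using finY by (intro card_mono) auto
    also have "\<dots> \<le> card (?Y - G (fst l))" using finY by (intro card_image_le) auto
    finally show ?thesis .
  qed
  have badY: "measure ?M {y\<in>?Y. ?ah l y \<noteq> ?t l y} \<le> 3 * d" if "fst l < m" for l
  proof -
    have "?Y - G (fst l) = {y\<in>?Y. ?t (fst l, False) (?t (fst l, True) y) \<noteq> y}"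
      by (auto simp: G_def)
    then have "real (card (?Y - G (fst l))) / real (card ?Y) < 3 * d"
      using n(1)[rule_format, of "fst l"] that by (simp add: measure_uniform_Collect[OF finY])
    moreover have "measure ?M {y\<in>?Y. ?ah l y \<noteq> ?t l y} \<le> real (card (?Y - G (fst l))) / real (card ?Y)"
      unfolding measure_uniform_Collect[OF finY] using card_bad[of l] by (intro divide_right_mono) auto
    ultimately show ?thesis by linarith
  qed
  have ah_meas: "measure ?M {y\<in>?Y. ?ah l y \<in> B} \<le> measure ?M B" if B: "B \<subseteq> ?Y" for l B
  proof -
    have "card {y\<in>?Y. ?ah l y \<in> B} \<le> card B"
      using B finY bij_betw_imp_inj_on[OF bij_ah[of l]]
      by (intro card_inj_on_le[of "?ah l"]) (auto intro: inj_on_subset finite_subset)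
    then show ?thesis
      unfolding measure_uniform_Collect[OF finY] measure_uniform_count_measure[OF finY B]
      by (intro divide_right_mono) auto
  qed

  \<comment> \<open>Comparison of the pattern frequencies\<close>
  have "\<exists>U\<in>sets ?M. measure ?M U \<le> real (card (words m (Suc m))) * (3 * d) \<and>
      (\<forall>y\<in>space ?M - U. \<forall>r\<le>m. pattern ?ah (lab n) r y = pattern ?t (lab n) r y)"
    using d bij_betwE[OF bij_ah] ah_meas badY
    by (intro pattern_perturbation MY.finite_measure_axioms)
      (auto simp: space_uniform_count_measure sets_uniform_count_measure)
  then obtain U where U: "U \<in> sets ?M" "measure ?M U \<le> N * (3 * d)"
    "\<And>y r. y \<in> space ?M - U \<Longrightarrow> r \<le> m \<Longrightarrow> pattern ?ah (lab n) r y = pattern ?t (lab n) r y"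
    unfolding N_def by blast
  have "\<exists>V\<in>sets cantor. measure cantor V \<le> real (card (words m (Suc m))) * d \<and>
      (\<forall>x\<in>space cantor - V. \<forall>r\<le>m. pattern ?a2 (\<lambda>x. x) r x = pattern s (\<lambda>x. x) r x)"
    using d a2_sets badX badX_sets measure_act_X_vimage[OF gen2 mu2]
    by (intro pattern_perturbation X.finite_measure_axioms) auto
  then obtain V where V: "V \<in> sets cantor" "measure cantor V \<le> N * d"
    "\<And>x r. x \<in> space cantor - V \<Longrightarrow> r \<le> m \<Longrightarrow> pattern ?a2 (\<lambda>x. x) r x = pattern s (\<lambda>x. x) r x"
    unfolding N_def by blast
  have "\<bar>pattern_freq_Y ?Y h (lab n) r b - pattern_freq_X \<theta>2 r b\<bar> < e" if r: "r \<le> m" for r b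
  proof -
    have 1: "\<bar>pattern_freq_Y ?Y h (lab n) r b - ?fY n r b\<bar> \<le> measure ?M U"
      unfolding pattern_freq_Y_def using U(3)[OF _ r]
      by (intro MY.abs_measure_diff_le U(1))
        (auto simp: space_uniform_count_measure sets_uniform_count_measure)
    have 2: "\<bar>pattern_freq_X \<theta>2 r b - ?fX r b\<bar> \<le> measure cantor V"
      unfolding pattern_freq_X_def using V(3)[OF _ r]
      by (intro X.abs_measure_diff_le V(1) sets_pattern m2 ms) auto
    have 3: "\<bar>?fY n r b - ?fX r b\<bar> < e / 4"
    proof (cases "b \<in> ?F r")
      case True
      then show ?thesis using n(2) r by blast
    next
      case False
      have "pattern act l r z \<noteq> b" for act l and z :: nat
        using pattern_in[of act l r z] False by metis
      moreover have "pattern act l r z \<noteq> b" for act l and z :: "nat \<Rightarrow> bool"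
        using pattern_in[of act l r z] False by metis
      ultimately show ?thesis using e by simp
    qed
    show ?thesis using 1 2 3 U(2) V(2) Nd by linarith
  qed
  then show ?thesis using fin_h by blast
qed

theorem theorem2p1:
  fixes \<theta>1 \<theta>2 :: "nat \<Rightarrow> (nat \<Rightarrow> bool) \<Rightarrow> (nat \<Rightarrow> bool)"
  assumes "borel_action \<theta>1" and "mu_preserving \<theta>1"
    and "borel_action \<theta>2" and "mu_preserving \<theta>2"
    and "AE x in cantor. orbit_X \<theta>1 x = orbit_X \<theta>2 x"
    and "sofic \<theta>1"
  shows "sofic \<theta>2"
proof -
  obtain Y g lab where "\<And>n. fin_action (Y n) (g n)"
    "\<And>r c. 1 \<le> r \<Longrightarrow>
      (\<lambda>n. pattern_freq_Y (Y n) (g n) (lab n) r c) \<longlonglongrightarrow> pattern_freq_X \<theta>1 r c"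
    using assms(6) unfolding sofic_iff_pattern[OF assms(1)] by blast
  note approx = sofic_model_approx[OF assms(1,3,4,5) this]
  \<comment> \<open>Diagonal sequence: model \<open>m\<close> serves all radii up to
    \<open>m\<close> with error \<open>1 / (m + 1)\<close>, so for each fixed radius the error tends
    to zero.\<close>
  let ?P = "\<lambda>m Y g lab. fin_action Y g \<and> (\<forall>r\<le>m. \<forall>c.
      \<bar>pattern_freq_Y Y g lab r c - pattern_freq_X \<theta>2 r c\<bar> < inverse (real (Suc m)))"
  have ex: "\<forall>m. \<exists>Y g lab. ?P m Y g lab"
  proof (rule allI, rule approx)
    show "0 < inverse (real (Suc m))" for m
      by (simp only: inverse_positive_iff_positive of_nat_0_less_iff zero_less_Suc)
  qed
  obtain Y' where Y': "\<forall>m. \<exists>g lab. ?P m (Y' m) g lab" by (rule exE[OF choice[OF ex]])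
  obtain g' where g': "\<forall>m. \<exists>lab. ?P m (Y' m) (g' m) lab" by (rule exE[OF choice[OF Y']])
  obtain lab' where lab': "\<forall>m. ?P m (Y' m) (g' m) (lab' m)" by (rule exE[OF choice[OF g']])
  have fin': "fin_action (Y' m) (g' m)" for m using lab' by blast
  have close: "\<bar>pattern_freq_Y (Y' m) (g' m) (lab' m) r c - pattern_freq_X \<theta>2 r c\<bar>
      < inverse (real (Suc m))" if "r \<le> m" for m r c
    using lab'[rule_format, of m] that by blast
  have "(\<lambda>m. pattern_freq_Y (Y' m) (g' m) (lab' m) r c) \<longlonglongrightarrow> pattern_freq_X \<theta>2 r c" for r c
  proof (rule Lim_transform2[of "\<lambda>_. pattern_freq_X \<theta>2 r c"])
    show "(\<lambda>m. pattern_freq_X \<theta>2 r c - pattern_freq_Y (Y' m) (g' m) (lab' m) r c) \<longlonglongrightarrow> 0"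
    proof (rule Lim_null_comparison[OF _ LIMSEQ_inverse_real_of_nat])
      show "\<forall>\<^sub>F m in sequentially. norm (pattern_freq_X \<theta>2 r c -
          pattern_freq_Y (Y' m) (g' m) (lab' m) r c) \<le> inverse (real (Suc m))"
        using eventually_ge_at_top[of r]
      proof eventually_elim
        case (elim m)
        show ?case
          using close[OF elim, of c] unfolding real_norm_def by (subst abs_minus_commute) (rule less_imp_le)
      qed
    qed
  qed simp
  then show ?thesis unfolding sofic_iff_pattern[OF assms(3)] using fin' by blast
qed

end
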